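(* Let $\Omega\subset\mathbb{R}^3$ be a bounded domain with Lipschitz boundary and let $k\ge 0$ be fixed. Let $D$ be a nonempty open subset of $\mathbb{R}^3$ with $\overline{D}\subset\Omega$. Assume that $D=\bigcup_{j=1}^N D_j$ with $1\le N<\infty$, where each $D_j$ is a connected component of $D$ with Lipschitz boundary, and $\overline{D_j}\cap\overline{D_l}=\emptyset$ if $j\ne l$. Let $x\in\Omega$ and $\sigma\in N_x$, and let $\{v_n\}\in\mathcal{N}(x,\sigma)$ be a needle sequence for $(x,\sigma)$ satisfying $$\lim_{n\to\infty}\Vert\nabla v_n\Vert_{L^2(D)}=\infty.$$ Then $$\lim_{n\to\infty}\frac{\Vert v_n\Vert_{L^2(D)}}{\Vert\nabla v_n\Vert_{L^2(D)}}=0.$$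
   Context: Functions are complex-valued. Needles: given $x\in\Omega$, a needle with tip at $x$ is a piecewise linear, non-self-intersecting curve $\sigma:[0,1]\to\overline{\Omega}$ with $\sigma(0)\in\partial\Omega$, $\sigma(1)=x$ and $\sigma(t)\in\Omega$ for all $t\in\,]0,1[$. The set of all needles with tip at $x$ is denoted $N_x$. The image $\sigma([0,1])$ is also written $\sigma$. Needle sequences: let $G_k(z,x)=\dfrac{e^{ik|z-x|}}{4\pi|z-x|}$ for $z\ne x$. Given $x\in\Omega$ and $\sigma\in N_x$, a sequence $\{v_n\}$ in $H^1(\Omega)$ is a needle sequence for $(x,\sigma)$ if each $v_n$ is a weak solution of $\Delta v+k^2v=0$ in $\Omega$ and, for every compact set $K\subset\mathbb{R}^3$ with $K\subset\Omega\setminus\sigma$, $$\lim_{n\to\infty}\Big(\Vert v_n-G_k(\cdot,x)\Vert_{L^2(K)}+\Vert\nabla(v_n-G_k(\cdot,x))\Vert_{L^2(K)}\Big)=0.$$ The set of all needle sequences for $(x,\sigma)$ is denoted $\mathcal{N}(x,\sigma)$. *)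

theory Defs
  imports "HOL-Analysis.Analysis"
begin

subsection \<open>Domains with Lipschitz boundary\<close>

text \<open>
  Near each boundary point, in suitable Cartesian coordinates, the set is the part above the graph
  of a Lipschitz function. In particular the set lies on one side of its boundary. Since a Lipschitz
  function on a disc extends to the plane, it is no restriction to take it to be globally defined.
\<close>

definition lipschitz_boundary :: "(real^3) set \<Rightarrow> bool" where
  "lipschitz_boundary A \<longleftrightarrow>
     (\<forall>p\<in>frontier A. \<exists>r>0. \<exists>T :: real^3 \<Rightarrow> real^3. \<exists>\<gamma> :: real \<times> real \<Rightarrow> real. \<exists>L.
        orthogonal_transformation T \<and> L-lipschitz_on UNIV \<gamma> \<and>
        A \<inter> ball p r = {y \<in> ball p r. \<gamma> (T y $ 1, T y $ 2) < T y $ 3})"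

subsection \<open>Test functions\<close>

definition partial :: "3 \<Rightarrow> (real^3 \<Rightarrow> complex) \<Rightarrow> real^3 \<Rightarrow> complex" where
  "partial i f y = frechet_derivative f (at y) (axis i 1)"

primrec C_k :: "nat \<Rightarrow> (real^3 \<Rightarrow> complex) \<Rightarrow> bool" where
  "C_k 0 f \<longleftrightarrow> continuous_on UNIV f"
| "C_k (Suc m) f \<longleftrightarrow> (\<forall>y. f differentiable (at y)) \<and> (\<forall>i. C_k m (partial i f))"

definition test_functions :: "(real^3) set \<Rightarrow> (real^3 \<Rightarrow> complex) set" where
  "test_functions \<Omega> = {\<phi>. (\<forall>m. C_k m \<phi>) \<and>
     compact (closure {y. \<phi> y \<noteq> 0}) \<and> closure {y. \<phi> y \<noteq> 0} \<subseteq> \<Omega>}"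

subsection \<open>Square integrable functions, weak gradients and the Sobolev space \<open>H\<^sup>1\<close>\<close>

text \<open>
  Elements of Lebesgue and Sobolev spaces are represented by functions instead of classes modulo
  equality almost everywhere. All notions below only depend on the class.
\<close>

definition square_integrable :: "(real^3) set \<Rightarrow> (real^3 \<Rightarrow> 'b::euclidean_space) \<Rightarrow> bool" where
  "square_integrable A f \<longleftrightarrow> f \<in> borel_measurable (lebesgue_on A) \<and>
     integrable (lebesgue_on A) (\<lambda>y. (norm (f y))\<^sup>2)"

text \<open>
  Only meaningful for functions that are square integrable on \<open>A\<close>: otherwise the Bochner integral
  has the default value \<open>0\<close>.
\<close>

definition L2_norm_on :: "(real^3) set \<Rightarrow> (real^3 \<Rightarrow> 'b::euclidean_space) \<Rightarrow> real" where
  "L2_norm_on A f = sqrt (LINT y|lebesgue_on A. (norm (f y))\<^sup>2)"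

definition locally_integrable :: "(real^3) set \<Rightarrow> (real^3 \<Rightarrow> 'b::euclidean_space) \<Rightarrow> bool" where
  "locally_integrable \<Omega> f \<longleftrightarrow> (\<forall>K. compact K \<and> K \<subseteq> \<Omega> \<longrightarrow> integrable (lebesgue_on K) f)"

definition has_weak_gradient ::
    "(real^3) set \<Rightarrow> (real^3 \<Rightarrow> complex) \<Rightarrow> (real^3 \<Rightarrow> complex^3) \<Rightarrow> bool" where
  "has_weak_gradient \<Omega> u g \<longleftrightarrow> locally_integrable \<Omega> u \<and> locally_integrable \<Omega> g \<and>
     (\<forall>\<phi>\<in>test_functions \<Omega>. \<forall>i.
        (LINT y|lebesgue_on \<Omega>. u y * partial i \<phi> y) = - (LINT y|lebesgue_on \<Omega>. g y $ i * \<phi> y))"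

text \<open>
  On an open set a weak gradient is unique up to equality almost everywhere, so the choice is
  immaterial when a weak gradient exists. It is arbitrary otherwise.
\<close>

definition weak_gradient ::
    "(real^3) set \<Rightarrow> (real^3 \<Rightarrow> complex) \<Rightarrow> real^3 \<Rightarrow> complex^3" where
  "weak_gradient \<Omega> u = (SOME g. has_weak_gradient \<Omega> u g)"

definition H1 :: "(real^3) set \<Rightarrow> (real^3 \<Rightarrow> complex) set" where
  "H1 \<Omega> = {u. square_integrable \<Omega> u \<and>
     (\<exists>g. has_weak_gradient \<Omega> u g \<and> square_integrable \<Omega> g)}"

definition helmholtz_weak_solution :: "(real^3) set \<Rightarrow> real \<Rightarrow> (real^3 \<Rightarrow> complex) \<Rightarrow> bool" where
  "helmholtz_weak_solution \<Omega> k v \<longleftrightarrow> v \<in> H1 \<Omega> \<and>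
     (\<forall>\<phi>\<in>test_functions \<Omega>.
        (LINT y|lebesgue_on \<Omega>. - (\<Sum>i\<in>UNIV. weak_gradient \<Omega> v y $ i * partial i \<phi> y)
           + (complex_of_real k)\<^sup>2 * v y * \<phi> y) = 0)"

subsection \<open>Needles and needle sequences\<close>

definition piecewise_linear :: "(real \<Rightarrow> real^3) \<Rightarrow> bool" where
  "piecewise_linear \<sigma> \<longleftrightarrow> (\<exists>(m::nat) (t :: nat \<Rightarrow> real). t 0 = 0 \<and> t m = 1 \<and>
     (\<forall>i<m. t i < t (Suc i) \<and> (\<exists>a b. \<forall>s\<in>{t i..t (Suc i)}. \<sigma> s = a + s *\<^sub>R b)))"

definition needles :: "(real^3) set \<Rightarrow> real^3 \<Rightarrow> (real \<Rightarrow> real^3) set" where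
  "needles \<Omega> x = {\<sigma>. piecewise_linear \<sigma> \<and> arc \<sigma> \<and> path_image \<sigma> \<subseteq> closure \<Omega> \<and>
     \<sigma> 0 \<in> frontier \<Omega> \<and> \<sigma> 1 = x \<and> (\<forall>t. 0 < t \<and> t < 1 \<longrightarrow> \<sigma> t \<in> \<Omega>)}"

definition G :: "real \<Rightarrow> real^3 \<Rightarrow> real^3 \<Rightarrow> complex" where
  "G k z x = exp (\<i> * complex_of_real (k * norm (z - x))) / complex_of_real (4 * pi * norm (z - x))"

text \<open>
  The difference \<open>v n - G k \<cdot> x\<close> is only considered on \<open>\<Omega> - {x}\<close>, where \<open>G k \<cdot> x\<close> is smooth. It
  and its weak gradient are square integrable on every compact subset, so that the two norms below
  are the genuine ones.
\<close>

definition needle_sequences ::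
    "(real^3) set \<Rightarrow> real \<Rightarrow> real^3 \<Rightarrow> (real \<Rightarrow> real^3) \<Rightarrow> (nat \<Rightarrow> real^3 \<Rightarrow> complex) set" where
  "needle_sequences \<Omega> k x \<sigma> = {v.
     (\<forall>n. v n \<in> H1 \<Omega> \<and> helmholtz_weak_solution \<Omega> k (v n)) \<and>
     (\<forall>K. compact K \<and> K \<subseteq> \<Omega> - path_image \<sigma> \<longrightarrow>
        (\<lambda>n. L2_norm_on K (\<lambda>z. v n z - G k z x)
             + L2_norm_on K (weak_gradient (\<Omega> - {x}) (\<lambda>z. v n z - G k z x))) \<longlonglongrightarrow> 0)}"

end

theory Submission
  imports Defs
begin

text \<open>
  No compact embedding is needed. Shifting by a vector \<open>h\<close> costs
  \<open>\<parallel>v(\<cdot> + h) - v\<parallel> \<le> |h| \<parallel>\<nabla>v\<parallel>\<close> in the \<open>L\<^sup>2\<close> norm. By the cone property of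
  Lipschitz domains, \<open>D\<close> is covered by finitely many open sets \<open>U\<close>, each of which can be shifted within
  \<open>D\<close> along an open set of arbitrarily small vectors. The needle \<open>\<sigma>\<close> is a polygon, so the differences of
  its points lie in finitely many planes, and a small admissible \<open>h\<close> can be chosen with \<open>\<sigma> + h\<close> disjoint
  from \<open>\<sigma>\<close>. Then for each \<open>y \<in> U\<close> one of \<open>y\<close>, \<open>y + h\<close> stays away from \<open>\<sigma>\<close>, that is, lies in a compact
  set \<open>K \<subseteq> \<Omega> - \<sigma>\<close>. This gives \<open>\<parallel>v\<parallel>\<^sup>2 \<le> M (3 \<parallel>v\<parallel>\<^sup>2 + 2 \<epsilon>\<^sup>2 \<parallel>\<nabla>v\<parallel>\<^sup>2)\<close>,
  with the norms taken on \<open>D\<close>, \<open>K\<close>, \<open>D\<close> and \<open>M\<close> independent of \<open>\<epsilon>\<close>. A needle sequence is bounded in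
  \<open>L\<^sup>2(K)\<close>, while its gradients blow up on \<open>D\<close>.
\<close>

subsection \<open>Smooth bump functions on boxes\<close>

text \<open>The derivative is existentially quantified at every level, so closure under sums,
  products and affine substitutions follows by induction without formulas for higher
  derivatives.\<close>

primrec diff_n :: "nat \<Rightarrow> (real \<Rightarrow> real) \<Rightarrow> bool" where
  "diff_n 0 f \<longleftrightarrow> True"
| "diff_n (Suc m) f \<longleftrightarrow> (\<exists>f'. (\<forall>t. (f has_real_derivative f' t) (at t)) \<and> diff_n m f')"

lemma diff_n_SucD: "diff_n (Suc m) f \<Longrightarrow> diff_n m f"
  by (induction m arbitrary: f) auto

lemma diff_n_add: "diff_n m f \<Longrightarrow> diff_n m g \<Longrightarrow> diff_n m (\<lambda>t. f t + g t)"
proof (induction m arbitrary: f g)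
  case (Suc m)
  then obtain f' g' where *: "\<forall>t. (f has_real_derivative f' t) (at t)" "diff_n m f'"
    "\<forall>t. (g has_real_derivative g' t) (at t)" "diff_n m g'" by auto
  then have "\<forall>t. ((\<lambda>t. f t + g t) has_real_derivative (f' t + g' t)) (at t)"
    by (auto intro!: derivative_eq_intros)
  with Suc.IH[OF *(2,4)] show ?case by auto
qed simp

lemma diff_n_mult: "diff_n m f \<Longrightarrow> diff_n m g \<Longrightarrow> diff_n m (\<lambda>t. f t * g t)"
proof (induction m arbitrary: f g)
  case (Suc m)
  then obtain f' g' where *: "\<forall>t. (f has_real_derivative f' t) (at t)" "diff_n m f'"
    "\<forall>t. (g has_real_derivative g' t) (at t)" "diff_n m g'" by auto
  have "\<forall>t. ((\<lambda>t. f t * g t) has_real_derivative (f' t * g t + f t * g' t)) (at t)"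
    using * by (auto intro!: derivative_eq_intros)
  moreover have "diff_n m (\<lambda>t. f' t * g t + f t * g' t)"
    using Suc.IH[OF *(2) diff_n_SucD[OF Suc.prems(2)]] Suc.IH[OF diff_n_SucD[OF Suc.prems(1)] *(4)]
    by (rule diff_n_add)
  ultimately show ?case by (auto intro!: exI[of _ "\<lambda>t. f' t * g t + f t * g' t"])
qed simp

lemma diff_n_affine: "diff_n m f \<Longrightarrow> diff_n m (\<lambda>t. e * f (c * t + d))"
proof (induction m arbitrary: f e)
  case (Suc m)
  then obtain f' where *: "\<forall>t. (f has_real_derivative f' t) (at t)" "diff_n m f'" by auto
  have "\<forall>t. ((\<lambda>t. e * f (c * t + d)) has_real_derivative ((e * c) * f' (c * t + d))) (at t)"
    using * by (auto intro!: derivative_eq_intros DERIV_chain'[where g=f])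
  with Suc.IH[OF *(2), of "e * c"] show ?case by auto
qed simp

text \<open>For \<open>p = 1\<close> this is the classical smooth function exp(-1/t), extended by 0.
  The polynomial factor in 1/t makes the family closed under differentiation.\<close>

definition flat :: "real poly \<Rightarrow> real \<Rightarrow> real" where
  "flat p t = (if 0 < t then poly p (1 / t) * exp (- (1 / t)) else 0)"

lemma poly_exp_minus_tendsto: "((\<lambda>s. poly p s * exp (- s)) \<longlongrightarrow> (0::real)) at_top"
proof -
  have "((\<lambda>s. \<Sum>i\<le>degree p. coeff p i * (s ^ i / exp s)) \<longlongrightarrow> (\<Sum>i\<le>degree p. coeff p i * 0)) at_top"
    by (intro tendsto_intros tendsto_power_div_exp_0)
  then show ?thesis
    by (simp add: poly_altdef sum_distrib_right exp_minus divide_inverse mult.assoc)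
qed

lemma flat_tendsto_0: "(flat p \<longlongrightarrow> 0) (at 0)"
proof -
  have "((\<lambda>t. poly p (inverse t) * exp (- inverse t)) \<longlongrightarrow> (0::real)) (at_right 0)"
    using filterlim_compose[OF poly_exp_minus_tendsto filterlim_inverse_at_top_right] .
  then have "(flat p \<longlongrightarrow> 0) (at_right 0)"
    by (rule Lim_transform_eventually)
      (auto simp: flat_def eventually_at_filter divide_inverse)
  moreover have "(flat p \<longlongrightarrow> 0) (at_left 0)"
    by (rule tendsto_eventually) (auto simp: flat_def eventually_at_filter)
  ultimately show ?thesis using filterlim_split_at by blast
qed

text \<open>With s = 1/t one has ds/dt = -s^2, so the derivative of p(s) exp(-s) is s^2 (p(s) -
  p'(s)) exp(-s), which is again of the form \<open>flat\<close>.\<close>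

lemma flat_has_derivative:
  "(flat p has_real_derivative flat ([:0, 0, 1:] * (p - pderiv p)) t) (at t)"
proof -
  consider "t < 0" | "t = 0" | "0 < t" by linarith
  then show ?thesis
  proof cases
    case 1
    have "((\<lambda>t. 0) has_real_derivative 0) (at t)" by simp
    then have "(flat p has_real_derivative 0) (at t)"
      by (rule has_field_derivative_transform_within_open[where S = "{..<0}"]) (use 1 in \<open>auto simp: flat_def\<close>)
    then show ?thesis using 1 by (simp add: flat_def)
  next
    case 2
    \<comment> \<open>The difference quotient at 0 is \<open>flat p y / y\<close>. For y > 0 the
      factor 1/y shifts the coefficients of \<open>p\<close>, which turns the quotient into
      \<open>flat (pCons 0 p) y\<close>.\<close>
    have "(flat (pCons 0 p) \<longlongrightarrow> 0) (at 0)" by (rule flat_tendsto_0)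
    then have "((\<lambda>y. (flat p y - flat p 0) / (y - 0)) \<longlongrightarrow> 0) (at 0)"
      by (rule Lim_transform_eventually) (auto simp: flat_def eventually_at_filter)
    then show ?thesis using 2 by (simp add: has_field_derivative_iff flat_def)
  next
    case 3
    have d: "((\<lambda>t. 1 / t) has_real_derivative - (1 / t)\<^sup>2) (at t)"
      using 3 by (auto intro!: derivative_eq_intros simp: power2_eq_square)
    have "((\<lambda>t. poly p (1 / t) * exp (- (1 / t))) has_real_derivative
        poly ([:0, 0, 1:] * (p - pderiv p)) (1 / t) * exp (- (1 / t))) (at t)"
      by (rule DERIV_cong[OF DERIV_mult[OF DERIV_chain2[OF poly_DERIV d] DERIV_fun_exp[OF DERIV_minus[OF d]]]])
        (simp add: algebra_simps power2_eq_square)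
    then have "(flat p has_real_derivative
        poly ([:0, 0, 1:] * (p - pderiv p)) (1 / t) * exp (- (1 / t))) (at t)"
      by (rule has_field_derivative_transform_within_open[where S = "{0<..}"]) (use 3 in \<open>auto simp: flat_def\<close>)
    then show ?thesis using 3 by (simp add: flat_def)
  qed
qed

lemma diff_n_flat: "diff_n m (flat p)"
  by (induction m arbitrary: p) (use flat_has_derivative in auto)

text \<open>
  Scaling \<open>t\<close> by \<open>n\<close> raises \<open>exp (- (1 / t))\<close> to the power \<open>1 / n\<close>. So the support stays
  \<open>[a, b]\<close> while the function tends to the indicator of \<open>(a, b)\<close>.
\<close>

definition bump1 :: "nat \<Rightarrow> real \<Rightarrow> real \<Rightarrow> real \<Rightarrow> real" where
  "bump1 n a b t = flat 1 (real (Suc n) * (t - a)) * flat 1 (real (Suc n) * (b - t))"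

lemma diff_n_bump1: "diff_n m (bump1 n a b)"
proof -
  have "diff_n m (\<lambda>t. (1 * flat 1 (real (Suc n) * t + - (real (Suc n) * a))) *
      (1 * flat 1 (- real (Suc n) * t + real (Suc n) * b)))"
    by (intro diff_n_mult diff_n_affine diff_n_flat)
  then show ?thesis
    unfolding bump1_def by (simp add: algebra_simps)
qed

lemma bump1_nonneg: "0 \<le> bump1 n a b t"
  by (simp add: bump1_def flat_def)

lemma bump1_le_1: "bump1 n a b t \<le> 1"
  unfolding bump1_def flat_def by (auto intro!: mult_le_one)

lemma bump1_eq_0: "\<not> (a < t \<and> t < b) \<Longrightarrow> bump1 n a b t = 0"
  by (auto simp: bump1_def flat_def zero_less_mult_iff)

lemma bump1_tendsto: "(\<lambda>n. bump1 n a b t) \<longlonglongrightarrow> indicator {a<..<b} t"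
proof (cases "a < t \<and> t < b")
  case True
  have lim: "(\<lambda>n. exp (- (1 / (real (Suc n) * c)))) \<longlonglongrightarrow> 1" for c :: real
  proof -
    have "(\<lambda>n. exp (- (inverse (real (Suc n)) * (1 / c)))) \<longlonglongrightarrow> exp (- (0 * (1 / c)))"
      by (intro tendsto_intros LIMSEQ_inverse_real_of_nat)
    then show ?thesis by (simp add: field_simps)
  qed
  have "(\<lambda>n. exp (- (1 / (real (Suc n) * (t - a)))) * exp (- (1 / (real (Suc n) * (b - t))))) \<longlonglongrightarrow> 1 * 1"
    by (intro tendsto_mult lim)
  with True show ?thesis by (simp add: bump1_def flat_def zero_less_mult_iff)
qed (auto simp: bump1_eq_0)

section \<open>Test functions on three-space as products of functions of one variable\<close>

definition prod3 :: "(real \<Rightarrow> real) \<Rightarrow> (real \<Rightarrow> real) \<Rightarrow> (real \<Rightarrow> real) \<Rightarrow> real^3 \<Rightarrow> complex" where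
  "prod3 f g h y = complex_of_real (f (y $ 1) * g (y $ 2) * h (y $ 3))"

lemma prod3_has_derivative:
  assumes "\<And>t. (f has_real_derivative f' t) (at t)" "\<And>t. (g has_real_derivative g' t) (at t)"
    "\<And>t. (h has_real_derivative h' t) (at t)"
  shows "(prod3 f g h has_derivative (\<lambda>e. e $ 1 *\<^sub>R prod3 f' g h y + e $ 2 *\<^sub>R prod3 f g' h y
    + e $ 3 *\<^sub>R prod3 f g h' y)) (at y)"
proof -
  have 1: "((\<lambda>y. F (y $ i)) has_derivative (\<lambda>e. F' (y $ i) * e $ i)) (at y)"
    if "\<And>t. (F has_real_derivative F' t) (at t)" for F F' and i :: 3
    using that[of "y $ i"] unfolding has_field_derivative_def
    by (rule has_derivative_compose[OF bounded_linear.has_derivative[OF bounded_linear_vec_nth has_derivative_ident]])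
  show ?thesis
    unfolding prod3_def[abs_def]
    by (rule has_derivative_eq_rhs[OF has_derivative_of_real[OF
          has_derivative_mult[OF has_derivative_mult[OF 1[OF assms(1)] 1[OF assms(2)]] 1[OF assms(3)]]]])
      (auto simp: fun_eq_iff scaleR_conv_of_real algebra_simps)
qed

lemma partial_prod3:
  assumes "\<And>t. (f has_real_derivative f' t) (at t)" "\<And>t. (g has_real_derivative g' t) (at t)"
    "\<And>t. (h has_real_derivative h' t) (at t)"
  shows "partial 1 (prod3 f g h) = prod3 f' g h" "partial 2 (prod3 f g h) = prod3 f g' h"
    "partial 3 (prod3 f g h) = prod3 f g h'"
  by (auto simp: partial_def fun_eq_iff axis_def 
      frechet_derivative_at[OF prod3_has_derivative[OF assms], symmetric])

text \<open>Each partial derivative differentiates a single factor, so the induction stays among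
  products. The index is shifted by one because \<open>diff_n 0\<close> says nothing: continuity in
  \<open>C_k 0\<close> is drawn from one derivative.\<close>

lemma C_k_prod3: "diff_n (Suc m) f \<Longrightarrow> diff_n (Suc m) g \<Longrightarrow> diff_n (Suc m) h \<Longrightarrow> C_k m (prod3 f g h)"
proof (induction m arbitrary: f g h)
  case 0
  then obtain f' g' h' where *: "\<And>t. (f has_real_derivative f' t) (at t)"
    "\<And>t. (g has_real_derivative g' t) (at t)" "\<And>t. (h has_real_derivative h' t) (at t)"
    by auto
  show ?case
    using has_derivative_continuous[OF prod3_has_derivative[OF *]]
    by (simp add: continuous_at_imp_continuous_on)
next
  case (Suc m)
  obtain f' g' h' where *: "\<And>t. (f has_real_derivative f' t) (at t)"
    "\<And>t. (g has_real_derivative g' t) (at t)" "\<And>t. (h has_real_derivative h' t) (at t)"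
    and **: "diff_n (Suc m) f'" "diff_n (Suc m) g'" "diff_n (Suc m) h'"
    using Suc.prems diff_n.simps(2)[of "Suc m"] by (metis (no_types))
  note *** = diff_n_SucD[OF Suc.prems(1)] diff_n_SucD[OF Suc.prems(2)] diff_n_SucD[OF Suc.prems(3)]
  have "C_k m (partial i (prod3 f g h))" for i
    using exhaust_3[of i] Suc.IH[OF **(1) ***(2,3)] Suc.IH[OF ***(1) **(2) ***(3)] Suc.IH[OF ***(1,2) **(3)]
    by (auto simp: partial_prod3[OF *])
  then show ?case
    using prod3_has_derivative[OF *] unfolding C_k.simps differentiable_def by blast
qed

definition bump :: "nat \<Rightarrow> real^3 \<Rightarrow> real^3 \<Rightarrow> real^3 \<Rightarrow> complex" where
  "bump n a b = prod3 (bump1 n (a $ 1) (b $ 1)) (bump1 n (a $ 2) (b $ 2)) (bump1 n (a $ 3) (b $ 3))"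

lemma C_k_bump: "C_k m (bump n a b)"
  unfolding bump_def by (intro C_k_prod3 diff_n_bump1)

lemma bump_eq_0: "y \<notin> box a b \<Longrightarrow> bump n a b y = 0"
  unfolding mem_box_cart forall_3 bump_def prod3_def using bump1_eq_0 by fastforce

lemma norm_bump_le: "norm (bump n a b y) \<le> 1"
  unfolding bump_def prod3_def norm_of_real
  by (auto simp: abs_mult bump1_nonneg intro!: mult_le_one bump1_le_1)

lemma bump_tendsto: "(\<lambda>n. bump n a b y) \<longlonglongrightarrow> indicator (box a b) y"
proof -
  have "(\<lambda>n. bump n a b y) \<longlonglongrightarrow> complex_of_real (indicator {a $ 1<..<b $ 1} (y $ 1)
      * indicator {a $ 2<..<b $ 2} (y $ 2) * indicator {a $ 3<..<b $ 3} (y $ 3))"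
    unfolding bump_def prod3_def by (intro tendsto_intros bump1_tendsto)
  also have "complex_of_real (indicator {a $ 1<..<b $ 1} (y $ 1)
      * indicator {a $ 2<..<b $ 2} (y $ 2) * indicator {a $ 3<..<b $ 3} (y $ 3)) = indicator (box a b) y"
    by (auto simp: indicator_def mem_box_cart forall_3)
  finally show ?thesis .
qed

lemma bump_in_test_functions: "cbox a b \<subseteq> \<Omega> \<Longrightarrow> bump n a b \<in> test_functions \<Omega>"
proof -
  assume "cbox a b \<subseteq> \<Omega>"
  moreover have "closure {y. bump n a b y \<noteq> 0} \<subseteq> cbox a b"
    using bump_eq_0 box_subset_cbox by (intro closure_minimal) fastforce+
  ultimately show ?thesis
    using C_k_bump bounded_subset[OF bounded_cbox, of "{y. bump n a b y \<noteq> 0}" a b]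
      closure_subset[of "{y. bump n a b y \<noteq> 0}"]
    unfolding test_functions_def by auto
qed

lemma bump_translate: "bump n a b (y - c) = bump n (a + c) (b + c) y"
  by (simp add: bump_def prod3_def bump1_def algebra_simps)

lemma bump_has_derivative: "(bump n a b has_derivative frechet_derivative (bump n a b) (at y)) (at y)"
  using C_k_bump[of 1 n a b] by (simp add: frechet_derivative_works)

lemma frechet_derivative_bump:
  "frechet_derivative (bump n a b) (at y) e = (\<Sum>i\<in>UNIV. e $ i *\<^sub>R partial i (bump n a b) y)"
proof -
  interpret linear "frechet_derivative (bump n a b) (at y)"
    using has_derivative_linear[OF bump_has_derivative] .
  have "frechet_derivative (bump n a b) (at y) (\<Sum>i\<in>UNIV. e $ i *\<^sub>R axis i 1) = (\<Sum>i\<in>UNIV. e $ i *\<^sub>R partial i (bump n a b) y)"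
    unfolding partial_def by (simp add: sum scale)
  also have "(\<Sum>i\<in>UNIV. e $ i *\<^sub>R axis i 1) = e"
    using basis_expansion[of e] by (simp add: scalar_mult_eq_scaleR)
  finally show ?thesis .
qed

lemma partial_bump_translate: "partial i (bump n (a + c) (b + c)) y = partial i (bump n a b) (y - c)"
proof -
  have "((\<lambda>y. bump n a b (y - c)) has_derivative frechet_derivative (bump n a b) (at (y - c))) (at y)"
    by (rule has_derivative_compose[where f="\<lambda>y. y - c" and g="bump n a b", OF _ bump_has_derivative, THEN has_derivative_eq_rhs])
       (auto intro!: derivative_eq_intros)
  then show ?thesis
    unfolding partial_def bump_translate by (metis frechet_derivative_at)
qed

lemma continuous_partial_bump: "continuous_on S (partial i (bump n a b))"
  using C_k_bump[of 1 n a b] by (auto intro: continuous_on_subset)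

text \<open>On the closed box the partial derivative is bounded by compactness. Off it the bump
  vanishes on an open neighbourhood, hence so does the derivative.\<close>

lemma partial_bump_bounded: "\<exists>B. \<forall>y. norm (partial i (bump n a b) y) \<le> B"
proof -
  have "compact (partial i (bump n a b) ` cbox a b)"
    by (intro compact_continuous_image continuous_partial_bump compact_cbox)
  then obtain B where B: "\<forall>y\<in>cbox a b. norm (partial i (bump n a b) y) \<le> B"
    by (auto dest!: compact_imp_bounded simp: bounded_iff)
  have "partial i (bump n a b) y = 0" if "y \<notin> cbox a b" for y
  proof -
    have "((\<lambda>_. 0) has_derivative (\<lambda>_. 0)) (at y)" by simp
    then have "(bump n a b has_derivative (\<lambda>_. 0)) (at y)"
      by (rule has_derivative_transform_within_open[where s="- cbox a b"])
        (use that box_subset_cbox bump_eq_0 in \<open>fastforce+\<close>)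
    then show ?thesis
      unfolding partial_def by (metis frechet_derivative_at)
  qed
  with B have "norm (partial i (bump n a b) y) \<le> max B 0" for y
    by (cases "y \<in> cbox a b") (auto intro: le_max_iff_disj[THEN iffD2])
  then show ?thesis by blast
qed

subsection \<open>Weak gradients along segments\<close>

text \<open>Open boxes are an intersection-stable generator of the Borel sets. So the integrals of
  \<open>w\<close> over all Borel parts of one box inside \<open>U\<close> vanish, which forces
  \<open>w\<close> to vanish almost everywhere there. By Lindelof countably many such boxes cover
  \<open>U\<close>.\<close>

lemma AE_zero_of_box_integrals:
  fixes w :: "'a::euclidean_space \<Rightarrow> 'b::{banach, second_countable_topology}"
  assumes w: "integrable lborel w" and U: "open U"
    and zero: "\<And>a b. cbox a b \<subseteq> U \<Longrightarrow> (LINT y:box a b|lborel. w y) = 0"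
  shows "AE y in lborel. y \<in> U \<longrightarrow> w y = 0"
proof -
  have box: "AE y in lborel. y \<in> box a b \<longrightarrow> w y = 0" if ab: "cbox a b \<subseteq> U" for a b
  proof -
    let ?f = "\<lambda>y. indicator (box a b) y *\<^sub>R w y"
    have int: "integrable lborel ?f"
      using w by (intro integrable_mult_indicator) auto
    have zero': "(LINT y:box c d \<inter> box a b|lborel. w y) = 0" for c d
    proof (cases "box c d \<inter> box a b = {}")
      case False
      then obtain p q where pq: "box c d \<inter> box a b = box p q" "box p q \<noteq> {}"
        unfolding box_Int_box by metis
      \<comment> \<open>The hypothesis \<open>zero\<close> asks for the closed box to lie in
        \<open>U\<close>. As \<open>box p q\<close> is nonempty, \<open>cbox p q\<close> is its
        closure and so inherits this from \<open>cbox a b\<close>.\<close>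
      then have "cbox p q \<subseteq> closure (box a b)"
        using closure_mono[of "box p q" "box a b"] by (metis Int_lower2 closure_box)
      then have "cbox p q \<subseteq> U" 
        using ab closure_minimal[OF box_subset_cbox closed_cbox, of a b] by blast
      then show ?thesis using zero pq by simp
    qed (simp add: set_lebesgue_integral_def)
    have "set_lebesgue_integral lborel A ?f = 0" if "A \<in> sets lborel" for A
    proof -
      have "Int_stable (range (\<lambda>(a, b). box a b :: 'a set))"
        by (auto simp: Int_stable_def box_Int_box)
      moreover have "range (\<lambda>(a, b). box a b :: 'a set) \<subseteq> Pow UNIV" by simp
      moreover have "A \<in> sigma_sets UNIV (range (\<lambda>(a, b). box a b))"
        using that unfolding sets_lborel borel_eq_box by simp
      ultimately show ?thesis
      proof (induction rule: sigma_sets_induct_disjoint)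
        case (basic A)
        then show ?case using zero' by (auto simp: set_lebesgue_integral_def indicator_inter_arith)
      next
        case empty
        then show ?case by (simp add: set_lebesgue_integral_def)
      next
        case (compl A)
        then have A: "A \<in> sets borel" by (simp add: borel_eq_box)
        have "set_lebesgue_integral lborel (UNIV - A) ?f = integral\<^sup>L lborel ?f - set_lebesgue_integral lborel A ?f"
        proof -
          have "indicator (UNIV - A) y *\<^sub>R ?f y = ?f y - indicator A y *\<^sub>R ?f y" for y
            by (auto simp: indicator_def)
          moreover have "integrable lborel (\<lambda>y. indicator A y *\<^sub>R ?f y)"
            using A by (intro integrable_mult_indicator[OF _ int]) simp
          ultimately show ?thesis
            unfolding set_lebesgue_integral_def using w
            by (simp add: Bochner_Integration.integral_diff[OF int])
        qed
        then show ?case using compl zero[OF ab] by (simp add: set_lebesgue_integral_def)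
      next
        case (union A)
        then have A: "A i \<in> sets lborel" for i by (auto simp: borel_eq_box)
        have "set_lebesgue_integral lborel (\<Union>i. A i) ?f = (\<Sum>i. set_lebesgue_integral lborel (A i) ?f)"
        proof (rule lebesgue_integral_countable_add)
          show "set_integrable lborel (\<Union>i. A i) ?f"
            unfolding set_integrable_def using A by (intro integrable_mult_indicator[OF _ int]) auto
        qed (use A union in \<open>auto simp: disjoint_family_on_def\<close>)
        then show ?case using union by simp
      qed
    qed
    then have "AE y in lborel. ?f y = 0"
      by (intro sigma_finite_measure.density_zero[OF sigma_finite_lborel int]) auto
    then show ?thesis
      by eventually_elim (auto simp: indicator_def split: if_splits)
  qed
  define \<F> where "\<F> = {box a b | a b. cbox a b \<subseteq> U}"
  have "\<And>X. X \<in> \<F> \<Longrightarrow> open X" by (auto simp: \<F>_def)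
  then obtain \<F>' where F: "\<F>' \<subseteq> \<F>" "countable \<F>'" "\<Union>\<F>' = \<Union>\<F>"
    by (rule Lindelof) blast
  have "U \<subseteq> \<Union>\<F>'"
    unfolding F(3)
  proof
    fix y assume "y \<in> U"
    then obtain a b where "cbox a b \<subseteq> U" "y \<in> box a b" using open_contains_cbox[OF U] by metis
    then show "y \<in> \<Union>\<F>" by (auto simp: \<F>_def)
  qed
  have "AE y in lborel. \<forall>X\<in>\<F>'. y \<in> X \<longrightarrow> w y = 0"
  proof (rule AE_ball_countable'[OF _ F(2)])
    fix X assume "X \<in> \<F>'"
    then obtain a b where "X = box a b" "cbox a b \<subseteq> U" using F(1) by (auto simp: \<F>_def)
    then show "AE y in lborel. y \<in> X \<longrightarrow> w y = 0" using box by simp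
  qed
  then show ?thesis
    by eventually_elim (use \<open>U \<subseteq> \<Union>\<F>'\<close> in auto)
qed

section \<open>Translations and averages along segments\<close>

lemma lborel_translate:
  fixes f :: "'a::euclidean_space \<Rightarrow> 'b::{banach, second_countable_topology}"
  shows integral_lborel_translate: "f \<in> borel_measurable borel \<Longrightarrow> (LINT y|lborel. f (y + c)) = integral\<^sup>L lborel f"
    and integrable_lborel_translate: "integrable lborel f \<Longrightarrow> integrable lborel (\<lambda>y. f (y + c))"
proof -
  show "(LINT y|lborel. f (y + c)) = integral\<^sup>L lborel f" if "f \<in> borel_measurable borel"
    using that by (subst (2) lborel_distr_plus[of c, symmetric], subst integral_distr) (auto simp: add.commute)
  show "integrable lborel (\<lambda>y. f (y + c))" if "integrable lborel f"
  proof -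
    have "integrable (distr lborel borel ((+) c)) f" using that by (simp add: lborel_distr_plus)
    then show ?thesis by (subst (asm) integrable_distr_eq) (use that in \<open>auto simp: add.commute\<close>)
  qed
qed

lemma nn_integral_lborel_translate:
  fixes f :: "'a::euclidean_space \<Rightarrow> ennreal"
  assumes "f \<in> borel_measurable borel"
  shows "(\<integral>\<^sup>+y. f (y + c) \<partial>lborel) = integral\<^sup>N lborel f"
  using assms by (subst (2) lborel_distr_plus[of c, symmetric], subst nn_integral_distr) (auto simp: add.commute)

text \<open>By translation invariance the integral of the norm over y is the same for every t, and t
  ranges over a bounded interval. This justifies the later uses of Fubini's theorem.\<close>

lemma integrable_along_segment:
  fixes f :: "'a::euclidean_space \<Rightarrow> 'b::{banach, second_countable_topology}"
  assumes "integrable lborel f"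
  shows "integrable (lborel \<Otimes>\<^sub>M lborel) (\<lambda>(t, y). indicator {0..1::real} t *\<^sub>R f (y + t *\<^sub>R h))"
proof (rule lborel_pair.Fubini_integrable)
  have [measurable]: "f \<in> borel_measurable borel" using assms by auto
  show "(\<lambda>(t, y). indicator {0..1::real} t *\<^sub>R f (y + t *\<^sub>R h)) \<in> borel_measurable (lborel \<Otimes>\<^sub>M lborel)"
    by measurable
  have "(LINT y|lborel. norm (f (y + t *\<^sub>R h))) = (LINT y|lborel. norm (f y))" for t
    using integral_lborel_translate[of "\<lambda>y. norm (f y)" "t *\<^sub>R h"] by simp
  then show "integrable lborel (\<lambda>t. LINT y|lborel. norm (case (t, y) of (t, y) \<Rightarrow> indicator {0..1::real} t *\<^sub>R f (y + t *\<^sub>R h)))"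
    by simp
  show "AE t in lborel. integrable lborel (\<lambda>y. case (t, y) of (t, y) \<Rightarrow> indicator {0..1::real} t *\<^sub>R f (y + t *\<^sub>R h))"
    using integrable_lborel_translate[OF assms] by (intro AE_I2) auto
qed

text \<open>For a gradient \<open>z\<close> this is the derivative in direction \<open>h\<close>; no
  complex conjugation occurs, as \<open>h\<close> is real.\<close>

definition dir :: "real^3 \<Rightarrow> complex^3 \<Rightarrow> complex" where
  "dir h z = (\<Sum>i\<in>UNIV. h $ i *\<^sub>R z $ i)"

lemma norm_dir_le: "norm (dir h z) \<le> norm h * norm z"
proof -
  have "norm (dir h z) \<le> (\<Sum>i\<in>UNIV. \<bar>h $ i\<bar> * \<bar>norm (z $ i)\<bar>)"
    unfolding dir_def by (rule norm_sum[THEN order_trans]) simp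
  also have "\<dots> \<le> L2_set (\<lambda>i. h $ i) UNIV * L2_set (\<lambda>i. norm (z $ i)) UNIV"
    by (rule L2_set_mult_ineq)
  finally show ?thesis by (simp add: norm_vec_def L2_set_def)
qed

lemma bounded_linear_dir: "bounded_linear (dir h)"
  unfolding dir_def by (intro bounded_linear_sum bounded_linear_scaleR_right[THEN bounded_linear_compose] bounded_linear_vec_nth)

text \<open>Fundamental theorem of calculus along the segment from y to y - h. The integral is
  written over the whole line with an indicator, ready for Fubini.\<close>

lemma bump_translate_diff:
  "bump n a b (y - h) - bump n a b y
    = - (LINT t|lborel. indicator {0..1} t *\<^sub>R dir h (\<chi> i. partial i (bump n a b) (y - t *\<^sub>R h)))"
proof -
  let ?P = "\<lambda>z. dir h (\<chi> i. partial i (bump n a b) z)"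
  have "((\<lambda>t. bump n a b (y - t *\<^sub>R h)) has_vector_derivative - ?P (y - t *\<^sub>R h)) (at t within {0..1})" for t
  proof -
    have "((\<lambda>t. bump n a b (y - t *\<^sub>R h)) has_derivative
        (\<lambda>s. frechet_derivative (bump n a b) (at (y - t *\<^sub>R h)) (- (s *\<^sub>R h)))) (at t)"
      by (rule has_derivative_compose[where g="bump n a b", OF _ bump_has_derivative])
         (auto intro!: derivative_eq_intros)
    then have "((\<lambda>t. bump n a b (y - t *\<^sub>R h)) has_vector_derivative - ?P (y - t *\<^sub>R h)) (at t)"
      unfolding has_vector_derivative_def frechet_derivative_bump dir_def
      by (simp add: scaleR_sum_right sum_negf)
    then show ?thesis by (rule has_vector_derivative_at_within)
  qed
  moreover have "continuous_on {0..1} (\<lambda>t. - ?P (y - t *\<^sub>R h))"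
    unfolding dir_def by (auto intro!: continuous_intros continuous_on_compose2[OF continuous_partial_bump[of UNIV]])
  ultimately have "(LINT t|lborel. indicator {0..1} t *\<^sub>R - ?P (y - t *\<^sub>R h)) = bump n a b (y - 1 *\<^sub>R h) - bump n a b (y - 0 *\<^sub>R h)"
    by (intro integral_FTC_Icc) auto
  then show ?thesis by simp
qed

text \<open>
  Tested against a bump, the left-hand side moves the shift onto the bump. The bump's difference is the
  integral of its directional derivative, and the weak gradient takes over under the integral sign.
\<close>

lemma weak_gradient_along_segment:
  fixes v :: "real^3 \<Rightarrow> complex" and g :: "real^3 \<Rightarrow> complex^3"
  assumes v: "integrable lborel v" and g: "integrable lborel g"
    and weak: "\<And>\<phi> i. \<phi> \<in> test_functions D \<Longrightarrow> (LINT y|lborel. v y * partial i \<phi> y) = - (LINT y|lborel. g y $ i * \<phi> y)"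
    and U: "open U" and sub: "\<And>y t. y \<in> U \<Longrightarrow> t \<in> {0..1} \<Longrightarrow> y + t *\<^sub>R h \<in> D"
  shows "AE y in lborel. y \<in> U \<longrightarrow> v (y + h) - v y = (LINT t|lborel. indicator {0..1} t *\<^sub>R dir h (g (y + t *\<^sub>R h)))"
proof -
  define W where "W y = (LINT t|lborel. indicator {0..1} t *\<^sub>R dir h (g (y + t *\<^sub>R h)))" for y
  define w where "w y = v (y + h) - v y - W y" for y
  have [measurable]: "v \<in> borel_measurable borel" using v by auto
  have dg: "integrable lborel (\<lambda>y. dir h (g y))"
    by (rule integrable_bounded_linear[OF bounded_linear_dir g])
  have [measurable]: "(\<lambda>y. dir h (g y)) \<in> borel_measurable borel" using dg by auto
  have seg: "integrable (lborel \<Otimes>\<^sub>M lborel) (\<lambda>(t, y). indicator {0..1::real} t *\<^sub>R dir h (g (y + t *\<^sub>R h)))"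
    by (rule integrable_along_segment[OF dg])
  have W: "integrable lborel W"
    unfolding W_def using lborel_pair.integrable_snd[OF seg] by simp
  have w: "integrable lborel w"
    unfolding w_def[abs_def] by (intro Bochner_Integration.integrable_diff integrable_lborel_translate v W)
  have bump0: "(LINT y|lborel. bump n a b y * w y) = 0" if ab: "cbox a b \<subseteq> U" for a b n
  proof -
    let ?\<phi> = "bump n a b" and ?P = "\<lambda>z. dir h (\<chi> i. partial i (bump n a b) z)"
    have cont: "continuous_on UNIV ?P" "continuous_on UNIV ?\<phi>"
      unfolding dir_def using C_k_bump[of 0 n a b]
      by (auto intro!: continuous_intros continuous_partial_bump)
    then have [measurable]: "?P \<in> borel_measurable borel" "?\<phi> \<in> borel_measurable borel"
      by (auto intro: borel_measurable_continuous_onI)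
    have partial_meas[measurable]: "partial i ?\<phi> \<in> borel_measurable borel" for i
      by (auto intro: borel_measurable_continuous_onI continuous_partial_bump)
    have mult_int: "integrable lborel (\<lambda>y. f y * \<psi> y)"
      if "integrable lborel f" "\<psi> \<in> borel_measurable borel" "\<And>y. norm (\<psi> y) \<le> C"
      for f \<psi> :: "real^3 \<Rightarrow> complex" and C
      using that order_trans[OF norm_ge_zero that(3)] by (intro Bochner_Integration.integrable_bound[OF integrable_mult_right[OF that(1), of "of_real C"]] AE_I2)
        (auto simp: norm_mult mult.commute intro!: mult_mono order_trans[OF _ abs_ge_self])
    \<comment> \<open>The bump sits in \<open>U\<close> and segments in direction \<open>h\<close>
      starting in \<open>U\<close> stay in \<open>D\<close>, so each translated bump is still an
      admissible test function on \<open>D\<close>.\<close>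
    have trans_test: "(\<lambda>y. ?\<phi> (y - t *\<^sub>R h)) \<in> test_functions D" if "t \<in> {0..1}" for t
    proof -
      have "cbox (a + t *\<^sub>R h) (b + t *\<^sub>R h) \<subseteq> D"
      proof
        fix z assume "z \<in> cbox (a + t *\<^sub>R h) (b + t *\<^sub>R h)"
        then have "z - t *\<^sub>R h \<in> cbox a b"
          by (auto simp: mem_box algebra_simps)
        with ab sub[of "z - t *\<^sub>R h" t] that show "z \<in> D" by auto
      qed
      then show ?thesis unfolding bump_translate by (rule bump_in_test_functions)
    qed
    obtain B where B: "\<And>i y. norm (partial i ?\<phi> y) \<le> B i"
      using partial_bump_bounded[of _ n a b] by metis
    have "norm (?P z) \<le> norm h * (\<Sum>i\<in>UNIV. B i)" for z
    proof -
      have "norm (\<chi> i. partial i ?\<phi> z) \<le> (\<Sum>i\<in>UNIV. B i)"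
        using B by (auto intro!: L2_set_le_sum[THEN order_trans] sum_mono simp: norm_vec_def)
      then show ?thesis
        by (intro norm_dir_le[THEN order_trans] mult_left_mono) auto
    qed
    then obtain C where P_le: "\<And>z. norm (?P z) \<le> C" by blast
    have H: "integrable (lborel \<Otimes>\<^sub>M lborel) (\<lambda>(t, y). v y * (indicator {0..1::real} t *\<^sub>R ?P (y - t *\<^sub>R h)))"
    proof (rule Bochner_Integration.integrable_bound)
      \<comment> \<open>The shift by \<open>t *\<^sub>R 0\<close> is a dummy. It brings the
        dominating function, a multiple of \<open>v\<close> on a strip, into the form treated by
        \<open>integrable_along_segment\<close>.\<close>
      show "integrable (lborel \<Otimes>\<^sub>M lborel) (\<lambda>(t, y). indicator {0..1::real} t *\<^sub>R (of_real C * v (y + t *\<^sub>R 0)))"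
        by (intro integrable_along_segment integrable_mult_right v)
      have "norm (v y * (indicator {0..1} t *\<^sub>R ?P (y - t *\<^sub>R h)))
          \<le> norm (indicator {0..1} t *\<^sub>R (of_real C * v (y + t *\<^sub>R 0)))" for t y
        using mult_right_mono[OF order_trans[OF P_le[of "y - t *\<^sub>R h"] abs_ge_self], of "norm (v y)"]
        by (auto simp: indicator_def norm_mult mult.commute)
      then show "AE p in lborel \<Otimes>\<^sub>M lborel. norm (case p of (t, y) \<Rightarrow> v y * (indicator {0..1::real} t *\<^sub>R ?P (y - t *\<^sub>R h)))
          \<le> norm (case p of (t, y) \<Rightarrow> indicator {0..1::real} t *\<^sub>R (of_real C * v (y + t *\<^sub>R 0)))"
        by (intro AE_I2) (auto simp only: split_beta)
    qed measurable
    \<comment> \<open>The weak gradient identity is applied to the translated bump. Substituting y +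
      t h for y then moves the translation from the bump to \<open>g\<close>.\<close>
    have inner: "(LINT y|lborel. v y * ?P (y - t *\<^sub>R h)) = - (LINT y|lborel. dir h (g (y + t *\<^sub>R h)) * ?\<phi> y)"
      if t: "t \<in> {0..1}" for t
    proof -
      have eq: "partial i (\<lambda>y. ?\<phi> (y - t *\<^sub>R h)) y = partial i ?\<phi> (y - t *\<^sub>R h)" for i y
        unfolding bump_translate partial_bump_translate ..
      have int1: "integrable lborel (\<lambda>y. v y * partial i ?\<phi> (y - t *\<^sub>R h))" for i
        using B by (intro mult_int[OF v, where C="B i"]) auto
      have int2: "integrable lborel (\<lambda>y. g y $ i * ?\<phi> (y - t *\<^sub>R h))" for i
        using norm_bump_le by (intro mult_int[where C=1] integrable_bounded_linear[OF bounded_linear_vec_nth g]) auto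
      have "(LINT y|lborel. v y * ?P (y - t *\<^sub>R h)) = (LINT y|lborel. (\<Sum>i\<in>UNIV. h $ i *\<^sub>R (v y * partial i ?\<phi> (y - t *\<^sub>R h))))"
        unfolding dir_def by (intro Bochner_Integration.integral_cong) (auto simp: sum_distrib_left)
      also have "\<dots> = (\<Sum>i\<in>UNIV. h $ i *\<^sub>R (LINT y|lborel. v y * partial i ?\<phi> (y - t *\<^sub>R h)))"
        using int1 by (subst Bochner_Integration.integral_sum) auto
      also have "\<dots> = - (\<Sum>i\<in>UNIV. h $ i *\<^sub>R (LINT y|lborel. g y $ i * ?\<phi> (y - t *\<^sub>R h)))"
        using weak[OF trans_test[OF t]] by (simp add: eq sum_negf)
      also have "\<dots> = - (LINT y|lborel. (\<Sum>i\<in>UNIV. h $ i *\<^sub>R (g y $ i * ?\<phi> (y - t *\<^sub>R h))))"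
        using int2 by (subst Bochner_Integration.integral_sum) auto
      also have "(LINT y|lborel. (\<Sum>i\<in>UNIV. h $ i *\<^sub>R (g y $ i * ?\<phi> (y - t *\<^sub>R h)))) = (LINT y|lborel. dir h (g y) * ?\<phi> (y - t *\<^sub>R h))"
        unfolding dir_def by (intro Bochner_Integration.integral_cong) (auto simp: sum_distrib_right)
      also have "\<dots> = (LINT y|lborel. dir h (g (y + t *\<^sub>R h)) * ?\<phi> y)"
        using integral_lborel_translate[of "\<lambda>y. dir h (g y) * ?\<phi> (y - t *\<^sub>R h)" "t *\<^sub>R h"] by simp
      finally show ?thesis .
    qed
    have seg\<phi>: "integrable (lborel \<Otimes>\<^sub>M lborel) (\<lambda>(t, y). (indicator {0..1::real} t *\<^sub>R dir h (g (y + t *\<^sub>R h))) * ?\<phi> y)"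
    proof (rule Bochner_Integration.integrable_bound[OF seg])
      show "AE p in lborel \<Otimes>\<^sub>M lborel. norm (case p of (t, y) \<Rightarrow> (indicator {0..1::real} t *\<^sub>R dir h (g (y + t *\<^sub>R h))) * ?\<phi> y)
          \<le> norm (case p of (t, y) \<Rightarrow> indicator {0..1::real} t *\<^sub>R dir h (g (y + t *\<^sub>R h)))"
        by (intro AE_I2) (auto simp: norm_mult norm_bump_le intro!: mult_left_mono mult_left_le)
    qed measurable
    have "(LINT y|lborel. v y * (?\<phi> (y - h) - ?\<phi> y))
        = - (LINT y|lborel. LINT t|lborel. v y * (indicator {0..1} t *\<^sub>R ?P (y - t *\<^sub>R h)))"
      unfolding bump_translate_diff
      by (simp only: mult_minus_right Bochner_Integration.integral_minus integral_mult_right_zero)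
    also have "\<dots> = - (LINT t|lborel. LINT y|lborel. v y * (indicator {0..1} t *\<^sub>R ?P (y - t *\<^sub>R h)))"
      using lborel_pair.Fubini_integral[OF H] by simp
    also have "\<dots> = (LINT t|lborel. LINT y|lborel. (indicator {0..1} t *\<^sub>R dir h (g (y + t *\<^sub>R h))) * ?\<phi> y)"
    proof -
      have "- (LINT y|lborel. v y * (indicator {0..1} t *\<^sub>R ?P (y - t *\<^sub>R h)))
          = (LINT y|lborel. (indicator {0..1} t *\<^sub>R dir h (g (y + t *\<^sub>R h))) * ?\<phi> y)" for t
        using inner[of t] by (cases "t \<in> {0..1}") auto
      then show ?thesis
        unfolding Bochner_Integration.integral_minus[symmetric] by (rule Bochner_Integration.integral_cong[OF refl])
    qed
    also have "\<dots> = (LINT y|lborel. LINT t|lborel. (indicator {0..1} t *\<^sub>R dir h (g (y + t *\<^sub>R h))) * ?\<phi> y)"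
      using lborel_pair.Fubini_integral[OF seg\<phi>] by simp
    also have "\<dots> = (LINT y|lborel. W y * ?\<phi> y)"
      unfolding W_def by (simp only: integral_mult_left_zero)
    finally have 1: "(LINT y|lborel. v y * (?\<phi> (y - h) - ?\<phi> y)) = (LINT y|lborel. W y * ?\<phi> y)" .
    have "(LINT y|lborel. v (y + h) * ?\<phi> y) = (LINT y|lborel. v y * ?\<phi> (y - h))"
      using integral_lborel_translate[of "\<lambda>y. v y * ?\<phi> (y - h)" h] by simp
    moreover have "integrable lborel (\<lambda>y. v (y + h) * ?\<phi> y)" "integrable lborel (\<lambda>y. v y * ?\<phi> y)"
      "integrable lborel (\<lambda>y. W y * ?\<phi> y)" "integrable lborel (\<lambda>y. v y * ?\<phi> (y - h))"
      using norm_bump_le by (auto intro!: mult_int[where C=1] integrable_lborel_translate v W)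
    ultimately show ?thesis
      using 1 by (simp add: w_def algebra_simps)
  qed
  \<comment> \<open>The bumps converge pointwise to the indicator of the box and are bounded by 1,
    so dominated convergence with majorant \<open>norm (w y)\<close> turns \<open>bump0\<close> into
    a statement on boxes.\<close>
  have "(LINT y:box a b|lborel. w y) = 0" if ab: "cbox a b \<subseteq> U" for a b
  proof -
    have "(\<lambda>n. LINT y|lborel. bump n a b y * w y) \<longlonglongrightarrow> (LINT y|lborel. indicator (box a b) y * w y)"
    proof (rule integral_dominated_convergence)
      show "integrable lborel (\<lambda>y. norm (w y))" using w by simp
      show "AE y in lborel. (\<lambda>n. bump n a b y * w y) \<longlonglongrightarrow> indicator (box a b) y * w y"
        by (intro AE_I2 tendsto_intros bump_tendsto)
      show "AE y in lborel. norm (bump n a b y * w y) \<le> norm (w y)" for n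
        by (intro AE_I2) (auto simp: norm_mult intro!: mult_left_le_one_le norm_bump_le)
    next
      have [measurable]: "bump n a b \<in> borel_measurable borel" for n
        using C_k_bump[of 0 n a b] by (auto intro: borel_measurable_continuous_onI)
      have [measurable]: "w \<in> borel_measurable borel" using w by auto
      show "(\<lambda>y. bump n a b y * w y) \<in> borel_measurable lborel" for n by measurable
      show "(\<lambda>y. indicator (box a b) y * w y) \<in> borel_measurable lborel" by measurable
    qed
    then have "(LINT y|lborel. indicator (box a b) y * w y) = 0"
      using bump0[OF ab] by (simp add: LIMSEQ_const_iff)
    moreover have "indicator (box a b) y * w y = indicator (box a b) y *\<^sub>R w y" for y
      by (simp add: indicator_def)
    ultimately show ?thesis unfolding set_lebesgue_integral_def by simp
  qed
  then have "AE y in lborel. y \<in> U \<longrightarrow> w y = 0"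
    by (intro AE_zero_of_box_integrals[OF w U]) auto
  then show ?thesis
    by eventually_elim (simp add: w_def W_def)
qed

subsection \<open>Shifts in \<open>L\<^sup>2\<close>\<close>

text \<open>When \<open>f\<close> is not integrable, the Bochner integral is 0 by default and the
  bound is trivial.\<close>

lemma norm_integral_le_nn_integral:
  fixes f :: "'a \<Rightarrow> 'b::{banach, second_countable_topology}"
  shows "ennreal (norm (integral\<^sup>L M f)) \<le> (\<integral>\<^sup>+x. norm (f x) \<partial>M)"
  by (cases "integrable M f") (auto simp: integral_norm_bound_ennreal not_integrable_integral_eq)

lemma nn_integral_along_segment:
  fixes f :: "'a::euclidean_space \<Rightarrow> ennreal"
  assumes [measurable]: "f \<in> borel_measurable borel"
  shows "(\<integral>\<^sup>+y. (\<integral>\<^sup>+t. indicator {0..1::real} t * f (y + t *\<^sub>R h) \<partial>lborel) \<partial>lborel) = integral\<^sup>N lborel f"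
proof -
  have "(\<lambda>(t, y). indicator {0..1::real} t * f (y + t *\<^sub>R h)) \<in> borel_measurable (lborel \<Otimes>\<^sub>M lborel)"
    by measurable
  then have "(\<integral>\<^sup>+y. (\<integral>\<^sup>+t. indicator {0..1::real} t * f (y + t *\<^sub>R h) \<partial>lborel) \<partial>lborel)
      = (\<integral>\<^sup>+t. (\<integral>\<^sup>+y. indicator {0..1::real} t * f (y + t *\<^sub>R h) \<partial>lborel) \<partial>lborel)"
    by (rule lborel_pair.Fubini')
  also have "\<dots> = (\<integral>\<^sup>+t. indicator {0..1::real} t * integral\<^sup>N lborel f \<partial>lborel)"
    by (intro nn_integral_cong) (simp add: nn_integral_cmult nn_integral_lborel_translate)
  also have "\<dots> = integral\<^sup>N lborel f"
    by (simp add: nn_integral_multc)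
  finally show ?thesis .
qed

text \<open>The difference is the integral over t in [0,1] of the directional derivative of
  \<open>v\<close>. Cauchy-Schwarz on the unit interval moves the square inside, and integration
  over y removes the shifts. The right-hand side integrates over the whole space because
  \<open>g\<close> will be extended by zero outside \<open>D\<close>.\<close>

lemma nn_integral_shift_difference_le:
  fixes v :: "real^3 \<Rightarrow> complex" and g :: "real^3 \<Rightarrow> complex^3"
  assumes v: "integrable lborel v" and g: "integrable lborel g"
    and weak: "\<And>\<phi> i. \<phi> \<in> test_functions D \<Longrightarrow> (LINT y|lborel. v y * partial i \<phi> y) = - (LINT y|lborel. g y $ i * \<phi> y)"
    and U: "open U" and sub: "\<And>y t. y \<in> U \<Longrightarrow> t \<in> {0..1} \<Longrightarrow> y + t *\<^sub>R h \<in> D"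
  shows "(\<integral>\<^sup>+y\<in>U. ennreal ((norm (v (y + h) - v y))\<^sup>2) \<partial>lborel)
    \<le> ennreal ((norm h)\<^sup>2) * (\<integral>\<^sup>+y. ennreal ((norm (g y))\<^sup>2) \<partial>lborel)"
proof -
  have [measurable]: "g \<in> borel_measurable borel" using g by auto
  let ?F = "\<lambda>y. ennreal ((norm h)\<^sup>2 * (norm (g y))\<^sup>2)"
  let ?S = "\<lambda>y. \<integral>\<^sup>+t. indicator {0..1::real} t * ?F (y + t *\<^sub>R h) \<partial>lborel"
  have le: "ennreal ((norm (LINT t|lborel. indicator {0..1} t *\<^sub>R dir h (g (y + t *\<^sub>R h))))\<^sup>2) \<le> ?S y" for y
  proof -
    let ?f = "\<lambda>t. indicator {0..1::real} t * ennreal (norm h * norm (g (y + t *\<^sub>R h)))"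
    have "ennreal (norm (LINT t|lborel. indicator {0..1} t *\<^sub>R dir h (g (y + t *\<^sub>R h))))
        \<le> (\<integral>\<^sup>+t. norm (indicator {0..1::real} t *\<^sub>R dir h (g (y + t *\<^sub>R h))) \<partial>lborel)"
      by (rule norm_integral_le_nn_integral)
    \<comment> \<open>The repeated indicator is the second factor for Cauchy-Schwarz; its square has
      integral 1.\<close>
    also have "\<dots> \<le> (\<integral>\<^sup>+t. ?f t * indicator {0..1} t \<partial>lborel)"
      by (intro nn_integral_mono) (auto simp: indicator_def norm_dir_le)
    finally have "(ennreal (norm (LINT t|lborel. indicator {0..1} t *\<^sub>R dir h (g (y + t *\<^sub>R h)))))\<^sup>2
        \<le> (\<integral>\<^sup>+t. ?f t * indicator {0..1} t \<partial>lborel)\<^sup>2"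
      by (intro power_mono) auto
    also have "\<dots> \<le> (\<integral>\<^sup>+t. (?f t)\<^sup>2 \<partial>lborel) * (\<integral>\<^sup>+t. (indicator {0..1::real} t)\<^sup>2 \<partial>lborel)"
      by (intro Cauchy_Schwarz_nn_integral) measurable
    also have "(\<integral>\<^sup>+t. (indicator {0..1::real} t)\<^sup>2 \<partial>lborel) = (\<integral>\<^sup>+t. indicator {0..1::real} t \<partial>lborel)"
      by (intro nn_integral_cong) (auto simp: indicator_def)
    also have "\<dots> = 1" by simp
    also have "(\<integral>\<^sup>+t. (?f t)\<^sup>2 \<partial>lborel) = ?S y"
      by (intro nn_integral_cong) (auto simp: indicator_def ennreal_power power_mult_distrib)
    finally show ?thesis by (simp add: ennreal_power)
  qed
  have "(\<integral>\<^sup>+y\<in>U. ennreal ((norm (v (y + h) - v y))\<^sup>2) \<partial>lborel) \<le> (\<integral>\<^sup>+y. ?S y \<partial>lborel)"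
  proof (rule nn_integral_mono_AE)
    show "AE y in lborel. ennreal ((norm (v (y + h) - v y))\<^sup>2) * indicator U y \<le> ?S y"
    proof -
      have "AE y in lborel. y \<in> U \<longrightarrow> v (y + h) - v y = (LINT t|lborel. indicator {0..1} t *\<^sub>R dir h (g (y + t *\<^sub>R h)))"
        by (rule weak_gradient_along_segment[OF v g weak U sub])
      then show ?thesis
      proof eventually_elim
        case (elim y)
        then show ?case using le[of y] by (cases "y \<in> U") auto
      qed
    qed
  qed
  also have "\<dots> = (\<integral>\<^sup>+y. ?F y \<partial>lborel)"
    by (rule nn_integral_along_segment) measurable
  also have "\<dots> = ennreal ((norm h)\<^sup>2) * (\<integral>\<^sup>+y. ennreal ((norm (g y))\<^sup>2) \<partial>lborel)"
    by (simp add: ennreal_mult nn_integral_cmult)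
  finally show ?thesis .
qed

text \<open>A point y of \<open>U\<close> in \<open>K\<close> is counted directly. For the others y
  + h is in \<open>K\<close>, and \<open>v y\<close> is estimated by \<open>v (y + h)\<close> and
  the shift difference. The constant 3 is 1 from the first case plus 2 from the second.\<close>

lemma nn_integral_norm_square_le_shift:
  fixes v :: "real^3 \<Rightarrow> complex" and g :: "real^3 \<Rightarrow> complex^3"
  assumes v: "integrable lborel v" and g: "integrable lborel g"
    and weak: "\<And>\<phi> i. \<phi> \<in> test_functions D \<Longrightarrow> (LINT y|lborel. v y * partial i \<phi> y) = - (LINT y|lborel. g y $ i * \<phi> y)"
    and U: "open U" and sub: "\<And>y t. y \<in> U \<Longrightarrow> t \<in> {0..1} \<Longrightarrow> y + t *\<^sub>R h \<in> D"
    and K: "closed K" and UK: "\<And>y. y \<in> U \<Longrightarrow> y \<in> K \<or> y + h \<in> K"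
  shows "(\<integral>\<^sup>+y\<in>U. ennreal ((norm (v y))\<^sup>2) \<partial>lborel)
    \<le> 3 * (\<integral>\<^sup>+y\<in>K. ennreal ((norm (v y))\<^sup>2) \<partial>lborel)
      + 2 * ennreal ((norm h)\<^sup>2) * (\<integral>\<^sup>+y. ennreal ((norm (g y))\<^sup>2) \<partial>lborel)"
proof -
  have [measurable]: "v \<in> borel_measurable borel" "U \<in> sets borel" "K \<in> sets borel"
    using v U K by auto
  let ?N = "\<lambda>y. ennreal ((norm (v y))\<^sup>2) * indicator K y"
  let ?V = "\<lambda>y. ennreal ((norm (v (y + h) - v y))\<^sup>2) * indicator U y"
  have "(norm (v y))\<^sup>2 \<le> 2 * (norm (v (y + h)))\<^sup>2 + 2 * (norm (v (y + h) - v y))\<^sup>2" for y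
  proof -
    have "norm (v y) \<le> norm (v (y + h)) + norm (v (y + h) - v y)"
      using norm_triangle_ineq4[of "v (y + h)" "v (y + h) - v y"] by simp
    then have "(norm (v y))\<^sup>2 \<le> (norm (v (y + h)) + norm (v (y + h) - v y))\<^sup>2"
      by (intro power_mono) auto
    also have "\<dots> \<le> 2 * (norm (v (y + h)))\<^sup>2 + 2 * (norm (v (y + h) - v y))\<^sup>2"
      using sum_squares_bound[of "norm (v (y + h))" "norm (v (y + h) - v y)"]
      by (simp add: power2_sum)
    finally show ?thesis .
  qed
  then have "ennreal ((norm (v y))\<^sup>2)
      \<le> ennreal (2 * (norm (v (y + h)))\<^sup>2 + 2 * (norm (v (y + h) - v y))\<^sup>2)" for y
    by (intro ennreal_leI)
  then have square: "ennreal ((norm (v y))\<^sup>2)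
      \<le> 2 * ennreal ((norm (v (y + h)))\<^sup>2) + 2 * ennreal ((norm (v (y + h) - v y))\<^sup>2)" for y
    by (simp add: ennreal_mult)
  have "ennreal ((norm (v y))\<^sup>2) * indicator U y \<le> ?N y + (2 * ?N (y + h) + 2 * ?V y)" for y
  proof (cases "y \<in> U")
    case True
    then show ?thesis using UK[of y] square[of y] by (cases "y \<in> K") (auto simp: add_increasing2)
  qed simp
  then have "(\<integral>\<^sup>+y\<in>U. ennreal ((norm (v y))\<^sup>2) \<partial>lborel) \<le> (\<integral>\<^sup>+y. ?N y + (2 * ?N (y + h) + 2 * ?V y) \<partial>lborel)"
    by (intro nn_integral_mono)
  also have "\<dots> = integral\<^sup>N lborel ?N + (2 * (\<integral>\<^sup>+y. ?N (y + h) \<partial>lborel) + 2 * integral\<^sup>N lborel ?V)"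
    by (simp add: nn_integral_add nn_integral_cmult)
  also have "(\<integral>\<^sup>+y. ?N (y + h) \<partial>lborel) = integral\<^sup>N lborel ?N"
    by (rule nn_integral_lborel_translate) measurable
  also have "integral\<^sup>N lborel ?N + (2 * integral\<^sup>N lborel ?N + 2 * integral\<^sup>N lborel ?V)
      = 3 * integral\<^sup>N lborel ?N + 2 * integral\<^sup>N lborel ?V"
  proof -
    have "(3 :: ennreal) = 1 + 2" by simp
    then show ?thesis by (simp only: distrib_right mult_1 add.assoc)
  qed
  also have "\<dots> \<le> 3 * integral\<^sup>N lborel ?N + 2 * (ennreal ((norm h)\<^sup>2) * (\<integral>\<^sup>+y. ennreal ((norm (g y))\<^sup>2) \<partial>lborel))"
    by (intro add_left_mono mult_left_mono nn_integral_shift_difference_le[OF v g weak U sub]) auto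
  finally show ?thesis by (simp add: mult.assoc)
qed

section \<open>Borel representatives of Lebesgue measurable functions\<close>

text \<open>The real-valued case is applied to each coordinate, and the finitely many null sets are
  combined. Representatives are wanted because translations and product measures are handled on
  \<open>lborel\<close>, while the Sobolev notions use \<open>lebesgue\<close>.\<close>

lemma lebesgue_measurable_ex_borel:
  fixes f :: "'a::euclidean_space \<Rightarrow> 'b::euclidean_space"
  assumes "f \<in> borel_measurable lebesgue"
  obtains f' where "f' \<in> borel_measurable borel" "AE y in lborel. f y = f' y"
proof -
  have "\<exists>f'. f' \<in> borel_measurable borel \<and> (AE y in lborel. f y \<bullet> b = f' y)" for b
  proof -
    have "(\<lambda>y. f y \<bullet> b) \<in> borel_measurable lebesgue" using assms by simp
    from completion_ex_borel_measurable_real[OF this] show ?thesis by auto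
  qed
  then obtain F where F: "\<And>b. F b \<in> borel_measurable borel" "\<And>b. AE y in lborel. f y \<bullet> b = F b y"
    by metis
  have "AE y in lborel. \<forall>b\<in>Basis. f y \<bullet> b = F b y"
    using F(2) by (intro AE_finite_allI) auto
  then have "AE y in lborel. f y = (\<Sum>b\<in>Basis. F b y *\<^sub>R b)"
  proof eventually_elim
    case (elim y)
    have "f y = (\<Sum>b\<in>Basis. (f y \<bullet> b) *\<^sub>R b)" by (simp add: euclidean_representation)
    also have "\<dots> = (\<Sum>b\<in>Basis. F b y *\<^sub>R b)" using elim by (intro sum.cong) auto
    finally show ?case .
  qed
  moreover have "(\<lambda>y. \<Sum>b\<in>Basis. F b y *\<^sub>R b) \<in> borel_measurable borel" using F(1) by simp
  ultimately show ?thesis by (rule that[rotated])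
qed

lemma integrable_lebesgue_ex_borel:
  fixes f :: "'a::euclidean_space \<Rightarrow> 'b::euclidean_space"
  assumes "integrable lebesgue f"
  obtains f' where "integrable lborel f'" "AE y in lborel. f y = f' y"
proof -
  have f: "f \<in> borel_measurable lebesgue" using assms by auto
  then obtain f' where f': "f' \<in> borel_measurable borel" "AE y in lborel. f y = f' y"
    by (rule lebesgue_measurable_ex_borel)
  have "f' \<in> borel_measurable lebesgue" using f'(1) by (intro measurable_completion) simp
  then have "integrable lebesgue f'"
    using assms f integrable_cong_AE[of f lebesgue f'] AE_completion[OF f'(2)] by blast
  then have "integrable lborel f'"
    using f'(1) integrable_completion[of f' lborel] by simp
  then show ?thesis using f'(2) by (rule that)
qed

subsection \<open>Polygons and Lipschitz domains\<close>

lemma pieces_cover: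
  fixes t :: "nat \<Rightarrow> real"
  assumes "t 0 \<le> s" "s \<le> t m" "0 < m"
  shows "\<exists>i<m. s \<in> {t i..t (Suc i)}"
  using assms
proof (induction m)
  case (Suc m)
  show ?case
  proof (cases "0 < m \<and> s \<le> t m")
    case True
    with Suc show ?thesis by (meson less_SucI)
  next
    case False
    with Suc.prems have "s \<in> {t m..t (Suc m)}" by (cases m) auto
    then show ?thesis by blast
  qed
qed simp

text \<open>Differences of points on two fixed linear pieces lie in a translate of the span of the
  two directions. This has dimension at most 2, hence measure zero in three-space, and there are
  finitely many pairs of pieces.\<close>

lemma negligible_piecewise_linear_differences:
  assumes "piecewise_linear \<sigma>"
  shows "negligible {p - q |p q. p \<in> path_image \<sigma> \<and> q \<in> path_image \<sigma>}"
proof -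
  obtain m :: nat and t :: "nat \<Rightarrow> real" where t: "t 0 = 0" "t m = 1"
    and seg: "\<forall>i<m. \<exists>a b. \<forall>s\<in>{t i..t (Suc i)}. \<sigma> s = a + s *\<^sub>R b"
    using assms unfolding piecewise_linear_def by metis
  obtain a b where ab: "\<And>i s. i < m \<Longrightarrow> s \<in> {t i..t (Suc i)} \<Longrightarrow> \<sigma> s = a i + s *\<^sub>R b i"
    using seg by metis
  have "0 < m" using t by (cases m) auto
  let ?P = "\<lambda>i j. (+) (a i - a j) ` span {b i, b j}"
  have piece: "\<exists>i<m. \<exists>s. p = a i + s *\<^sub>R b i" if p: "p \<in> path_image \<sigma>" for p
  proof -
    obtain s where s: "p = \<sigma> s" "0 \<le> s" "s \<le> 1"
      using p unfolding path_image_def by (metis atLeastAtMost_iff imageE)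
    then obtain i where "i < m" "s \<in> {t i..t (Suc i)}"
      using pieces_cover[of t s m] t \<open>0 < m\<close> by auto
    then show ?thesis using ab s by blast
  qed
  have "p - q \<in> (\<Union>i<m. \<Union>j<m. ?P i j)" if pq: "p \<in> path_image \<sigma>" "q \<in> path_image \<sigma>" for p q
  proof -
    obtain i s where i: "i < m" "p = a i + s *\<^sub>R b i" using piece[OF pq(1)] by blast
    obtain j u where j: "j < m" "q = a j + u *\<^sub>R b j" using piece[OF pq(2)] by blast
    have "s *\<^sub>R b i - u *\<^sub>R b j \<in> span {b i, b j}"
      by (intro span_diff span_scale span_base) auto
    then have "p - q \<in> ?P i j"
      by (intro image_eqI[where x = "s *\<^sub>R b i - u *\<^sub>R b j"]) (auto simp: i j)
    then show ?thesis using i j by blast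
  qed
  then have "{p - q |p q. p \<in> path_image \<sigma> \<and> q \<in> path_image \<sigma>} \<subseteq> (\<Union>i<m. \<Union>j<m. ?P i j)" by blast
  moreover have "negligible (?P i j)" for i j
  proof -
    have "dim {b i, b j} \<le> card {b i, b j}" by (rule dim_le_card') simp
    also have "\<dots> \<le> 2" by (simp add: card_insert_if)
    finally show ?thesis
      by (intro negligible_translation negligible_lowdim) (simp add: dim_span)
  qed
  then have "negligible (\<Union>i<m. \<Union>j<m. ?P i j)"
    by (intro negligible_Union) (auto intro!: negligible_Union)
  ultimately show ?thesis using negligible_subset by blast
qed

text \<open>The sets \<open>S\<close> and \<open>S\<close> shifted by \<open>h\<close> are disjoint
  and compact, so they have a positive distance d. If both y and y + h were closer to
  \<open>S\<close> than d/2, the triangle inequality would produce points of these two sets closer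
  than d.\<close>

lemma shift_away_from_compact:
  fixes S :: "'a::euclidean_space set"
  assumes "compact S" "S \<noteq> {}" and h: "\<And>p q. p \<in> S \<Longrightarrow> q \<in> S \<Longrightarrow> h \<noteq> p - q"
  obtains \<eta> where "\<eta> > 0" "\<And>y. infdist y S < \<eta> \<Longrightarrow> \<eta> \<le> infdist (y + h) S"
proof -
  have "(+) h ` S \<inter> S = {}" using h by (fastforce simp: algebra_simps)
  moreover have "compact ((+) h ` S)" using assms(1) by (rule compact_translation)
  ultimately obtain d where d: "d > 0" "\<And>p q. p \<in> (+) h ` S \<Longrightarrow> q \<in> S \<Longrightarrow> d \<le> dist p q"
    using separate_compact_closed[of "(+) h ` S" S] assms(1) compact_imp_closed by metis
  have "d / 2 \<le> infdist (y + h) S" if y: "infdist y S < d / 2" for y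
  proof (rule ccontr)
    assume less: "\<not> d / 2 \<le> infdist (y + h) S"
    obtain p where p: "p \<in> S" "infdist y S = dist y p"
      using infdist_attains_inf[OF compact_imp_closed[OF assms(1)] assms(2)] by metis
    obtain q where q: "q \<in> S" "infdist (y + h) S = dist (y + h) q"
      using infdist_attains_inf[OF compact_imp_closed[OF assms(1)] assms(2)] by metis
    have "dist (h + p) (h + y) < d / 2" using p y by (simp add: dist_commute)
    moreover have "dist (h + y) q < d / 2" using q less by (simp add: add.commute)
    ultimately have "dist (h + p) q < d"
      using dist_triangle[of "h + p" q "h + y"] by linarith
    then show False using d(2)[of "h + p" q] p q by force
  qed
  then show ?thesis using d that[of "d / 2"] by simp
qed

text \<open>
  A common open set of arbitrarily small admissible shifts is what the cone property of a Lipschitz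
  boundary provides. Openness leaves room to avoid a null set of shifts.
\<close>

definition shiftable :: "'a::real_normed_vector set \<Rightarrow> 'a set \<Rightarrow> bool" where
  "shiftable U A \<longleftrightarrow> open U \<and> (\<forall>\<epsilon>>0. \<exists>C. open C \<and> C \<noteq> {} \<and> C \<subseteq> ball 0 \<epsilon> \<and>
    (\<forall>h\<in>C. \<forall>y\<in>U. \<forall>t\<in>{0..1}. y + t *\<^sub>R h \<in> A))"

lemma shiftable_mono:
  assumes U: "shiftable U A" and AB: "A \<subseteq> B"
  shows "shiftable U B"
  unfolding shiftable_def
proof (intro conjI allI impI)
  show "open U" using U by (simp add: shiftable_def)
  fix \<epsilon> :: real assume "\<epsilon> > 0"
  then obtain C where C: "open C" "C \<noteq> {}" "C \<subseteq> ball 0 \<epsilon>"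
      "\<forall>h\<in>C. \<forall>y\<in>U. \<forall>t\<in>{0..1}. y + t *\<^sub>R h \<in> A"
    using U unfolding shiftable_def by metis
  from C(4) have "\<forall>h\<in>C. \<forall>y\<in>U. \<forall>t\<in>{0..1}. y + t *\<^sub>R h \<in> B"
    using subsetD[OF AB] by simp
  with C(1-3) show "\<exists>C. open C \<and> C \<noteq> {} \<and> C \<subseteq> ball 0 \<epsilon> \<and> (\<forall>h\<in>C. \<forall>y\<in>U. \<forall>t\<in>{0..1}. y + t *\<^sub>R h \<in> B)"
    by metis
qed

text \<open>Near an interior point every short vector is admissible. At a boundary point the vectors
  that rise more steeply than the Lipschitz graph are, since they move points above the graph to
  points above the graph.\<close>

lemma lipschitz_boundary_shiftable:
  assumes A: "lipschitz_boundary A" "open A" and p: "p \<in> closure A"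
  obtains r where "r > 0" "shiftable (A \<inter> ball p r) A"
proof (cases "p \<in> A")
  case True
  then obtain r where r: "r > 0" "ball p r \<subseteq> A" using A(2) open_contains_ball by metis
  have "\<exists>C. open C \<and> C \<noteq> {} \<and> C \<subseteq> ball 0 \<epsilon> \<and> (\<forall>h\<in>C. \<forall>y\<in>A \<inter> ball p (r / 2). \<forall>t\<in>{0..1}. y + t *\<^sub>R h \<in> A)"
    if "\<epsilon> > 0" for \<epsilon>
  proof (intro exI conjI ballI)
    show "open (ball 0 (min \<epsilon> (r / 2)) :: (real^3) set)" "ball 0 (min \<epsilon> (r / 2)) \<noteq> ({} :: (real^3) set)"
      "ball 0 (min \<epsilon> (r / 2)) \<subseteq> (ball 0 \<epsilon> :: (real^3) set)" using that r by auto
    fix h y :: "real^3" and t :: real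
    assume h: "h \<in> ball 0 (min \<epsilon> (r / 2))" and y: "y \<in> A \<inter> ball p (r / 2)" and t: "t \<in> {0..1}"
    have "norm (t *\<^sub>R h) \<le> norm h" using t by (auto intro: mult_left_le_one_le)
    moreover have "dist p (y + t *\<^sub>R h) \<le> dist p y + norm (t *\<^sub>R h)"
      using dist_triangle[of p "y + t *\<^sub>R h" y] by (simp add: dist_norm)
    ultimately have "y + t *\<^sub>R h \<in> ball p r" using h y by auto
    then show "y + t *\<^sub>R h \<in> A" using r by blast
  qed
  then show ?thesis using r A(2) by (intro that[of "r / 2"]) (auto simp: shiftable_def)
next
  case False
  with p A(2) have "p \<in> frontier A" by (simp add: frontier_def interior_open)
  then obtain r and T :: "real^3 \<Rightarrow> real^3" and \<gamma> L where r: "r > 0" and T: "orthogonal_transformation T"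
    and L: "L-lipschitz_on UNIV \<gamma>"
    and graph: "A \<inter> ball p r = {y \<in> ball p r. \<gamma> (T y $ 1, T y $ 2) < T y $ 3}"
    using bspec[OF A(1)[unfolded lipschitz_boundary_def]] by blast
  have lin: "linear T" using T by (rule orthogonal_transformation_linear)
  then have cont: "continuous_on UNIV T" by (simp add: linear_continuous_on linear_conv_bounded_linear)
  have "\<exists>C. open C \<and> C \<noteq> {} \<and> C \<subseteq> ball 0 \<epsilon> \<and> (\<forall>h\<in>C. \<forall>y\<in>A \<inter> ball p (r / 2). \<forall>t\<in>{0..1}. y + t *\<^sub>R h \<in> A)"
    if "\<epsilon> > 0" for \<epsilon>
  proof (intro exI conjI ballI)
    \<comment> \<open>The length is kept below \<open>r / 2\<close> so that points of
      \<open>ball p (r / 2)\<close> stay in \<open>ball p r\<close>, where the graph description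
      holds. The second condition is the open cone of steep vectors.\<close>
    define C where "C = ball 0 (min \<epsilon> (r / 2)) \<inter> {h. L * norm (T h $ 1, T h $ 2) < T h $ 3}"
    have "open {h. L * norm (T h $ 1, T h $ 2) < T h $ 3}"
      by (intro open_Collect_less continuous_intros cont)
    then show "open C" unfolding C_def by blast
    show "C \<subseteq> ball 0 \<epsilon>" by (auto simp: C_def)
    \<comment> \<open>The preimage of the vertical axis: its small positive multiples lie in the
      cone.\<close>
    obtain e where e: "T e = axis 3 1"
      using orthogonal_transformation_surj[OF T] by (metis surjD)
    have "norm e = 1" using orthogonal_transformation_norm[OF T, of e] e by simp
    define s where "s = min \<epsilon> (r / 2) / 2"
    have s: "0 < s" "s < \<epsilon>" "s < r / 2" using that r by (auto simp: s_def)
    have "T (s *\<^sub>R e) = s *\<^sub>R axis 3 1" using e linear_scale[OF lin] by simp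
    then have "s *\<^sub>R e \<in> C" using s \<open>norm e = 1\<close> by (auto simp: C_def axis_def)
    then show "C \<noteq> {}" by blast
    fix h y :: "real^3" and t :: real
    assume h: "h \<in> C" and y: "y \<in> A \<inter> ball p (r / 2)" and t: "t \<in> {0..1}"
    show "y + t *\<^sub>R h \<in> A"
    proof (cases "t = 0")
      case False
      have "norm (t *\<^sub>R h) \<le> norm h" using t by (auto intro: mult_left_le_one_le)
      moreover have "dist p (y + t *\<^sub>R h) \<le> dist p y + norm (t *\<^sub>R h)"
        using dist_triangle[of p "y + t *\<^sub>R h" y] by (simp add: dist_norm)
      ultimately have ball: "y + t *\<^sub>R h \<in> ball p r" using h y by (auto simp: C_def)
      have Tadd: "T (y + t *\<^sub>R h) = T y + t *\<^sub>R T h"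
        using lin by (simp add: linear_add linear_scale)
      have "\<gamma> (T y $ 1, T y $ 2) < T y $ 3"
      proof -
        have "y \<in> A \<inter> ball p r" using y r by auto
        then show ?thesis unfolding graph by simp
      qed
      moreover have "dist (\<gamma> (T (y + t *\<^sub>R h) $ 1, T (y + t *\<^sub>R h) $ 2)) (\<gamma> (T y $ 1, T y $ 2))
          \<le> L * dist (T (y + t *\<^sub>R h) $ 1, T (y + t *\<^sub>R h) $ 2) (T y $ 1, T y $ 2)"
        using L by (rule lipschitz_onD) auto
      moreover have "dist (T (y + t *\<^sub>R h) $ 1, T (y + t *\<^sub>R h) $ 2) (T y $ 1, T y $ 2) = norm (t *\<^sub>R (T h $ 1, T h $ 2))"
        by (simp add: Tadd dist_norm)
      then have "dist (T (y + t *\<^sub>R h) $ 1, T (y + t *\<^sub>R h) $ 2) (T y $ 1, T y $ 2) = t * norm (T h $ 1, T h $ 2)"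
        using t unfolding norm_scaleR by simp
      moreover have "t * (L * norm (T h $ 1, T h $ 2)) < t * (T h $ 3)"
        using h t False by (intro mult_strict_left_mono) (auto simp: C_def)
      ultimately have "\<gamma> (T (y + t *\<^sub>R h) $ 1, T (y + t *\<^sub>R h) $ 2) < T y $ 3 + t * (T h $ 3)"
        by (simp add: dist_real_def algebra_simps)
      also have "\<dots> = T (y + t *\<^sub>R h) $ 3" by (simp add: Tadd)
      finally show ?thesis using graph ball by blast
    qed (use y in simp)
  qed
  then show ?thesis using r A(2) by (intro that[of "r / 2"]) (auto simp: shiftable_def)
qed

text \<open>The closure of \<open>A\<close> is compact, so finitely many of the balls around its
  points, boundary points included, cover it.\<close>

lemma lipschitz_boundary_finite_cover:
  assumes "lipschitz_boundary A" "open A" "bounded A"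
  obtains \<U> where "finite \<U>" "A \<subseteq> \<Union>\<U>" "\<And>U. U \<in> \<U> \<Longrightarrow> shiftable U A"
proof -
  obtain r where r: "\<And>p. p \<in> closure A \<Longrightarrow> r p > 0 \<and> shiftable (A \<inter> ball p (r p)) A"
  proof -
    have "\<exists>r. p \<in> closure A \<longrightarrow> r > 0 \<and> shiftable (A \<inter> ball p r) A" for p
      using lipschitz_boundary_shiftable[OF assms(1,2)] by blast
    then show ?thesis using that by metis
  qed
  have "compact (closure A)" using assms(3) by simp
  moreover have "closure A \<subseteq> (\<Union>p\<in>closure A. ball p (r p))" using r by force
  ultimately obtain F where F: "F \<subseteq> closure A" "finite F" "closure A \<subseteq> (\<Union>p\<in>F. ball p (r p))"
    using compactE_image[of "closure A" "closure A" "\<lambda>p. ball p (r p)"] by (metis open_ball)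
  show ?thesis
  proof (rule that[of "(\<lambda>p. A \<inter> ball p (r p)) ` F"])
    show "A \<subseteq> \<Union>((\<lambda>p. A \<inter> ball p (r p)) ` F)"
      using F(3) closure_subset[of A] by auto
  qed (use F r in auto)
qed

text \<open>The set of admissible shifts is open and nonempty, so it is not contained in the null
  set of differences of points of the path. A shift outside this null set moves the path off itself,
  and \<open>K\<close> collects the points of the closure of \<open>D\<close> at distance at least
  \<eta> from the path.\<close>

lemma shiftable_avoiding_path:
  fixes D :: "(real^3) set"
  assumes U: "shiftable U D" and D: "bounded D" and \<sigma>: "piecewise_linear \<sigma>" "path \<sigma>" and "\<epsilon> > 0"
  obtains h K where "norm h < \<epsilon>" "compact K" "K \<subseteq> closure D - path_image \<sigma>"
    "\<And>y. y \<in> U \<Longrightarrow> y \<in> K \<or> y + h \<in> K" "\<And>y t. y \<in> U \<Longrightarrow> t \<in> {0..1} \<Longrightarrow> y + t *\<^sub>R h \<in> D"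
proof -
  obtain C where C: "open C" "C \<noteq> {}" "C \<subseteq> ball 0 \<epsilon>"
    and CD: "\<And>h y t. h \<in> C \<Longrightarrow> y \<in> U \<Longrightarrow> t \<in> {0..1} \<Longrightarrow> y + t *\<^sub>R h \<in> D"
    using U \<open>\<epsilon> > 0\<close> unfolding shiftable_def by metis
  have "\<not> negligible C" using C open_not_negligible by blast
  then have "\<not> C \<subseteq> {p - q |p q. p \<in> path_image \<sigma> \<and> q \<in> path_image \<sigma>}"
    using negligible_piecewise_linear_differences[OF \<sigma>(1)] negligible_subset by blast
  then obtain h where h: "h \<in> C" "\<And>p q. p \<in> path_image \<sigma> \<Longrightarrow> q \<in> path_image \<sigma> \<Longrightarrow> h \<noteq> p - q" by blast
  obtain \<eta> where \<eta>: "\<eta> > 0" "\<And>y. infdist y (path_image \<sigma>) < \<eta> \<Longrightarrow> \<eta> \<le> infdist (y + h) (path_image \<sigma>)"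
    using shift_away_from_compact[OF compact_path_image[OF \<sigma>(2)] path_image_nonempty h(2)] by metis
  define K where "K = closure D \<inter> {y. \<eta> \<le> infdist y (path_image \<sigma>)}"
  show ?thesis
  proof (rule that[of h K])
    show "norm h < \<epsilon>" using h C by auto
    have "closed {y. \<eta> \<le> infdist y (path_image \<sigma>)}"
      by (intro closed_Collect_le continuous_intros)
    then show "compact K" using D unfolding K_def by (intro compact_Int_closed) auto
    show "K \<subseteq> closure D - path_image \<sigma>" using \<eta>(1) by (auto simp: K_def)
    show "y \<in> K \<or> y + h \<in> K" if "y \<in> U" for y
      \<comment> \<open>Taking \<open>t = 0\<close> and \<open>t = 1\<close> shows that y and y + h
        both lie in \<open>D\<close>.\<close>
      using CD[OF h(1) that, of 0] CD[OF h(1) that, of 1] \<eta>(2)[of y] closure_subset[of D]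
      by (auto simp: K_def not_less[symmetric])
  qed (use CD h in blast)
qed

subsection \<open>Interpolation between a compact set and the gradient\<close>

text \<open>The closure of \<open>D\<close> is a compact subset of \<open>\<Omega>\<close>, so local
  integrability makes the extensions by zero from \<open>D\<close> integrable. Test functions on
  \<open>D\<close> are also test functions on \<open>\<Omega>\<close>, and they and their partial
  derivatives vanish off \<open>D\<close>, so neither side of the identity sees the
  truncation.\<close>

lemma has_weak_gradient_borel_representatives:
  fixes v :: "real^3 \<Rightarrow> complex" and g :: "real^3 \<Rightarrow> complex^3"
  assumes vg: "has_weak_gradient \<Omega> v g" and \<Omega>: "open \<Omega>"
    and D: "open D" "bounded D" "closure D \<subseteq> \<Omega>"
  obtains v' g' where "integrable lborel v'" "AE y in lborel. indicator D y *\<^sub>R v y = v' y"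
    "integrable lborel g'" "AE y in lborel. indicator D y *\<^sub>R g y = g' y"
    "\<And>\<phi> i. \<phi> \<in> test_functions D \<Longrightarrow> (LINT y|lborel. v' y * partial i \<phi> y) = - (LINT y|lborel. g' y $ i * \<phi> y)"
proof -
  have ext: "integrable lebesgue (\<lambda>y. indicator D y *\<^sub>R f y)" if "locally_integrable \<Omega> f"
    for f :: "real^3 \<Rightarrow> 'b::euclidean_space"
  proof -
    have "integrable (lebesgue_on (closure D)) f"
      using that D unfolding locally_integrable_def by (simp add: compact_closure)
    then have int: "integrable lebesgue (\<lambda>y. indicator (closure D) y *\<^sub>R f y)"
      by (subst (asm) integrable_restrict_space) auto
    have "integrable lebesgue (\<lambda>y. indicator D y *\<^sub>R indicator (closure D) y *\<^sub>R f y)"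
      using D(1) by (intro integrable_mult_indicator[OF _ int]) auto
    moreover have "indicator D y *\<^sub>R indicator (closure D) y *\<^sub>R f y = indicator D y *\<^sub>R f y" for y
      using closure_subset[of D] by (auto simp: indicator_def)
    ultimately show ?thesis by (simp only:)
  qed
  obtain v' where v': "integrable lborel v'" "AE y in lborel. indicator D y *\<^sub>R v y = v' y"
    using integrable_lebesgue_ex_borel[OF ext[of v]] vg unfolding has_weak_gradient_def by metis
  obtain g' where g': "integrable lborel g'" "AE y in lborel. indicator D y *\<^sub>R g y = g' y"
    using integrable_lebesgue_ex_borel[OF ext[of g]] vg unfolding has_weak_gradient_def by metis
  \<comment> \<open>Stated with a continuous \<open>F\<close> in order to serve both sides:
    \<open>F\<close> is the identity for \<open>v\<close> and a coordinate projection for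
    \<open>g\<close>.\<close>
  have to_lborel: "(LINT y|lebesgue_on \<Omega>. F (f y) * \<psi> y) = (LINT y|lborel. F (f' y) * \<psi> y)"
    if f': "integrable lborel f'" "AE y in lborel. indicator D y *\<^sub>R f y = f' y"
      and \<psi>: "continuous_on UNIV \<psi>" "\<And>y. y \<notin> D \<Longrightarrow> \<psi> y = 0"
      and F: "continuous_on UNIV F"
    for f f' :: "real^3 \<Rightarrow> 'b::euclidean_space" and F :: "'b \<Rightarrow> complex" and \<psi> :: "real^3 \<Rightarrow> complex"
  proof -
    have [measurable]: "f' \<in> borel_measurable borel" "\<psi> \<in> borel_measurable borel" "F \<in> borel_measurable borel"
      using f' \<psi> F by (auto intro: borel_measurable_continuous_onI)
    have meas: "(\<lambda>y. F (f' y) * \<psi> y) \<in> borel_measurable lborel" by measurable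
    have "D \<subseteq> \<Omega>" using D(3) closure_subset by blast
    have "AE y in lebesgue. indicator D y *\<^sub>R f y = f' y"
      using f'(2) by (rule AE_completion)
    then have eq: "AE y in lebesgue. F (f' y) * \<psi> y = indicator \<Omega> y *\<^sub>R (F (f y) * \<psi> y)"
    proof eventually_elim
      case (elim y)
      then show ?case using \<psi>(2)[of y] \<open>D \<subseteq> \<Omega>\<close> by (cases "y \<in> D") auto
    qed
    have meas': "(\<lambda>y. F (f' y) * \<psi> y) \<in> borel_measurable lebesgue"
      using meas by (rule measurable_completion)
    have "(\<lambda>y. indicator \<Omega> y *\<^sub>R (F (f y) * \<psi> y)) \<in> borel_measurable lebesgue"
      by (rule borel_measurable_AE[OF meas' eq])
    then have "(LINT y|lebesgue. F (f' y) * \<psi> y) = (LINT y|lebesgue. indicator \<Omega> y *\<^sub>R (F (f y) * \<psi> y))"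
      using meas' eq by (intro integral_cong_AE) auto
    then show ?thesis
      using integral_completion[OF meas] \<Omega> by (subst integral_restrict_space) auto
  qed
  have weak: "(LINT y|lborel. v' y * partial i \<phi> y) = - (LINT y|lborel. g' y $ i * \<phi> y)"
    if \<phi>: "\<phi> \<in> test_functions D" for \<phi> i
  proof -
    have supp: "closure {y. \<phi> y \<noteq> 0} \<subseteq> D" and C: "\<And>m. C_k m \<phi>"
      using \<phi> by (auto simp: test_functions_def)
    have "D \<subseteq> \<Omega>" using D(3) closure_subset by blast
    then have "\<phi> \<in> test_functions \<Omega>" using \<phi> by (auto simp: test_functions_def)
    then have eq: "(LINT y|lebesgue_on \<Omega>. v y * partial i \<phi> y) = - (LINT y|lebesgue_on \<Omega>. g y $ i * \<phi> y)"
      using vg unfolding has_weak_gradient_def by blast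
    have "partial i \<phi> y = 0" if "y \<notin> D" for y
    proof -
      have "((\<lambda>_. 0) has_derivative (\<lambda>_. 0)) (at y)" by simp
      then have "(\<phi> has_derivative (\<lambda>_. 0)) (at y)"
      proof (rule has_derivative_transform_within_open)
        show "open (- closure {y. \<phi> y \<noteq> 0})" "y \<in> - closure {y. \<phi> y \<noteq> 0}" using that supp by auto
        show "0 = \<phi> z" if "z \<in> - closure {y. \<phi> y \<noteq> 0}" for z
          using that closure_subset[of "{y. \<phi> y \<noteq> 0}"] by auto
      qed
      then show ?thesis unfolding partial_def by (metis frechet_derivative_at)
    qed
    moreover have "continuous_on UNIV (partial i \<phi>)" using C[of 1] by simp
    ultimately have 1: "(LINT y|lebesgue_on \<Omega>. v y * partial i \<phi> y) = (LINT y|lborel. v' y * partial i \<phi> y)"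
      by (intro to_lborel[of v' v _ "\<lambda>z. z", OF v']) auto
    have "\<phi> y = 0" if "y \<notin> D" for y
      using that supp closure_subset[of "{y. \<phi> y \<noteq> 0}"] by auto
    then have 2: "(LINT y|lebesgue_on \<Omega>. g y $ i * \<phi> y) = (LINT y|lborel. g' y $ i * \<phi> y)"
      using C[of 0] by (intro to_lborel[of g' g _ "\<lambda>z. z $ i", OF g']) (auto intro!: continuous_intros)
    show ?thesis using eq unfolding 1 2 .
  qed
  show ?thesis using v' g' weak by (rule that)
qed

text \<open>A divergent integral is infinite here, whereas \<open>L2_norm_on\<close> would give the
  default value 0. The estimates are therefore proved in this form and converted at the end.\<close>

abbreviation square_nn_integral :: "(real^3) set \<Rightarrow> (real^3 \<Rightarrow> 'b::real_normed_vector) \<Rightarrow> ennreal" where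
  "square_nn_integral A f \<equiv> \<integral>\<^sup>+y\<in>A. ennreal ((norm (f y))\<^sup>2) \<partial>lebesgue"

lemma square_nn_integral_eq_L2_norm_on:
  assumes "A \<in> sets lebesgue" "integrable (lebesgue_on A) (\<lambda>y. (norm (f y))\<^sup>2)"
  shows "square_nn_integral A f = ennreal ((L2_norm_on A f)\<^sup>2)"
proof -
  have "square_nn_integral A f = (\<integral>\<^sup>+y. ennreal ((norm (f y))\<^sup>2) \<partial>lebesgue_on A)"
    using assms(1) by (subst nn_integral_restrict_space) auto
  also have "\<dots> = ennreal (LINT y|lebesgue_on A. (norm (f y))\<^sup>2)"
    using assms(2) by (intro nn_integral_eq_integral) auto
  finally show ?thesis by (simp add: L2_norm_on_def)
qed

text \<open>
  The point is that the factor \<open>card \<U>\<close> does not depend on \<open>\<epsilon>\<close>.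
\<close>

lemma weak_gradient_interpolation:
  fixes D \<Omega> :: "(real^3) set"
  assumes \<Omega>: "open \<Omega>" and D: "open D" "bounded D" "closure D \<subseteq> \<Omega>"
    and cover: "finite \<U>" "D \<subseteq> \<Union>\<U>" "\<forall>U\<in>\<U>. shiftable U D"
    and \<sigma>: "piecewise_linear \<sigma>" "path \<sigma>" and "\<epsilon> > 0"
  obtains K where "compact K" "K \<subseteq> closure D - path_image \<sigma>"
    "\<forall>v g. has_weak_gradient \<Omega> v g \<longrightarrow> square_nn_integral D v
      \<le> of_nat (card \<U>) * (3 * square_nn_integral K v + 2 * ennreal (\<epsilon>\<^sup>2) * square_nn_integral D g)"
proof -
  let ?Q = "\<lambda>U h K. norm h < \<epsilon> \<and> compact K \<and> K \<subseteq> closure D - path_image \<sigma> \<and>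
      (\<forall>y\<in>U. y \<in> K \<or> y + h \<in> K) \<and> (\<forall>y\<in>U. \<forall>t\<in>{0..1}. y + t *\<^sub>R h \<in> D)"
  have "\<exists>h K. ?Q U h K" if U: "U \<in> \<U>" for U
    by (rule shiftable_avoiding_path[OF bspec[OF cover(3) U] D(2) \<sigma> \<open>\<epsilon> > 0\<close>]) blast
  then have "\<forall>U\<in>\<U>. \<exists>h K. ?Q U h K" by blast
  from bchoice[OF this] obtain h where "\<forall>U\<in>\<U>. \<exists>K. ?Q U (h U) K" by blast
  from bchoice[OF this] obtain K where Q: "\<forall>U\<in>\<U>. ?Q U (h U) (K U)" by blast
  have h: "norm (h U) < \<epsilon>" and K: "compact (K U)" "K U \<subseteq> closure D - path_image \<sigma>"
    and hK: "\<And>y. y \<in> U \<Longrightarrow> y \<in> K U \<or> y + h U \<in> K U"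
    and hD: "\<And>y t. y \<in> U \<Longrightarrow> t \<in> {0..1} \<Longrightarrow> y + t *\<^sub>R h U \<in> D" if "U \<in> \<U>" for U
    using bspec[OF Q that] by blast+
  \<comment> \<open>\<open>K'\<close> is fixed by the cover, the path and \<open>\<epsilon>\<close>
    before any function is considered, so one compact set serves all of them.\<close>
  define K' where "K' = (\<Union>U\<in>\<U>. K U)"
  have K': "compact K'" "K' \<subseteq> closure D - path_image \<sigma>"
    unfolding K'_def using cover(1) K by (auto intro!: compact_UN)
  have "square_nn_integral D v
      \<le> of_nat (card \<U>) * (3 * square_nn_integral K' v + 2 * ennreal (\<epsilon>\<^sup>2) * square_nn_integral D g)"
    if vg: "has_weak_gradient \<Omega> v g" for v g
  proof -
    obtain v' g' where v': "integrable lborel v'" "AE y in lborel. indicator D y *\<^sub>R v y = v' y"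
      and g': "integrable lborel g'" "AE y in lborel. indicator D y *\<^sub>R g y = g' y"
      and weak: "\<And>\<phi> i. \<phi> \<in> test_functions D \<Longrightarrow> (LINT y|lborel. v' y * partial i \<phi> y) = - (LINT y|lborel. g' y $ i * \<phi> y)"
      by (rule has_weak_gradient_borel_representatives[OF vg \<Omega> D]) blast
    have [measurable]: "v' \<in> borel_measurable borel" using v' by auto
    let ?V = "\<lambda>A. \<integral>\<^sup>+y\<in>A. ennreal ((norm (v' y))\<^sup>2) \<partial>lborel"
    let ?R = "3 * ?V K' + 2 * ennreal (\<epsilon>\<^sup>2) * (\<integral>\<^sup>+y. ennreal ((norm (g' y))\<^sup>2) \<partial>lborel)"
    have part: "?V U \<le> ?R" if U: "U \<in> \<U>" for U
    proof -
      have "closed K'" using K'(1) by (rule compact_imp_closed)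
      have "open U" using bspec[OF cover(3) U] by (simp add: shiftable_def)
      have KU: "y \<in> K' \<or> y + h U \<in> K'" if "y \<in> U" for y
        using hK[OF U that] U unfolding K'_def by blast
      have "?V U \<le> 3 * ?V K' + 2 * ennreal ((norm (h U))\<^sup>2) * (\<integral>\<^sup>+y. ennreal ((norm (g' y))\<^sup>2) \<partial>lborel)"
        by (rule nn_integral_norm_square_le_shift[OF v'(1) g'(1) weak \<open>open U\<close> hD[OF U] \<open>closed K'\<close> KU])
      also have "\<dots> \<le> ?R"
        using h[OF U] by (intro add_left_mono mult_right_mono mult_left_mono ennreal_leI power_mono) auto
      finally show ?thesis .
    qed
    have open_U: "U \<in> sets borel" if "U \<in> \<U>" for U
      using bspec[OF cover(3) that] by (simp add: shiftable_def)
    have "square_nn_integral D v = ?V D"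
      unfolding nn_integral_completion
      by (intro nn_integral_cong_AE) (use v'(2) in \<open>eventually_elim, auto simp: indicator_def\<close>)
    \<comment> \<open>Every point of \<open>D\<close> is counted at least once, and each member of
      the cover obeys the same bound \<open>?R\<close>. This is the source of the factor
      \<open>card \<U>\<close>.\<close>
    also have "\<dots> \<le> (\<integral>\<^sup>+y. (\<Sum>U\<in>\<U>. ennreal ((norm (v' y))\<^sup>2) * indicator U y) \<partial>lborel)"
    proof (rule nn_integral_mono)
      fix y
      show "ennreal ((norm (v' y))\<^sup>2) * indicator D y \<le> (\<Sum>U\<in>\<U>. ennreal ((norm (v' y))\<^sup>2) * indicator U y)"
      proof (cases "y \<in> D")
        case True
        then obtain U where "U \<in> \<U>" "y \<in> U" using cover(2) by blast
        then show ?thesis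
          using member_le_sum[of U \<U> "\<lambda>U. ennreal ((norm (v' y))\<^sup>2) * indicator U y"] cover(1) True by simp
      qed simp
    qed
    also have "\<dots> = (\<Sum>U\<in>\<U>. ?V U)"
      using open_U by (intro nn_integral_sum) simp
    also have "\<dots> \<le> (\<Sum>U\<in>\<U>. ?R)" by (intro sum_mono part)
    also have "\<dots> = of_nat (card \<U>) * ?R" by simp
    also have "\<dots> \<le> of_nat (card \<U>) * (3 * square_nn_integral K' v + 2 * ennreal (\<epsilon>\<^sup>2) * square_nn_integral D g)"
    proof (intro mult_left_mono add_mono)
      \<comment> \<open>Only an inequality: \<open>K'\<close> may meet the boundary of
        \<open>D\<close>, where \<open>v'\<close> vanishes almost everywhere but \<open>v\<close>
        may not.\<close>
      show "?V K' \<le> square_nn_integral K' v"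
        unfolding nn_integral_completion
      proof (rule nn_integral_mono_AE)
        show "AE y in lborel. ennreal ((norm (v' y))\<^sup>2) * indicator K' y \<le> ennreal ((norm (v y))\<^sup>2) * indicator K' y"
          using v'(2)
        proof eventually_elim
          case (elim y)
          then show ?case by (cases "y \<in> D") auto
        qed
      qed
      show "(\<integral>\<^sup>+y. ennreal ((norm (g' y))\<^sup>2) \<partial>lborel) \<le> square_nn_integral D g"
        unfolding nn_integral_completion
      proof (rule nn_integral_mono_AE)
        show "AE y in lborel. ennreal ((norm (g' y))\<^sup>2) \<le> ennreal ((norm (g y))\<^sup>2) * indicator D y"
          using g'(2)
        proof eventually_elim
          case (elim y)
          then show ?case by (cases "y \<in> D") auto
        qed
      qed
    qed auto
    finally show ?thesis .
  qed
  with K' show ?thesis by (intro that[of K']) auto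
qed

section \<open>Square integrability and norms on subsets\<close>

lemma square_integrable_subset:
  assumes "square_integrable A f" "A \<in> sets lebesgue" "B \<in> sets lebesgue" "B \<subseteq> A"
  shows "square_integrable B f"
proof -
  have f: "f \<in> borel_measurable (lebesgue_on A)" "integrable (lebesgue_on A) (\<lambda>y. (norm (f y))\<^sup>2)"
    using assms(1) by (auto simp: square_integrable_def)
  have "integrable lebesgue (\<lambda>y. indicator A y *\<^sub>R (norm (f y))\<^sup>2)"
    using f(2) assms(2) by (subst (asm) integrable_restrict_space) auto
  then have "integrable lebesgue (\<lambda>y. indicator B y *\<^sub>R indicator A y *\<^sub>R (norm (f y))\<^sup>2)"
    by (rule integrable_mult_indicator[OF assms(3)])
  moreover have "indicator B y *\<^sub>R indicator A y *\<^sub>R (norm (f y))\<^sup>2 = indicator B y *\<^sub>R (norm (f y))\<^sup>2" for y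
    using assms(4) by (auto simp: indicator_def)
  ultimately have "integrable lebesgue (\<lambda>y. indicator B y *\<^sub>R (norm (f y))\<^sup>2)"
    by (simp only:)
  then have "integrable (lebesgue_on B) (\<lambda>y. (norm (f y))\<^sup>2)"
    using assms(3) by (subst integrable_restrict_space) auto
  moreover have "f \<in> borel_measurable (lebesgue_on B)"
    using f(1) assms(4) by (rule measurable_restrict_mono)
  ultimately show ?thesis by (simp add: square_integrable_def)
qed

lemma norm_diff_square_le:
  fixes a b :: "'a::real_normed_vector"
  shows "(norm (a - b))\<^sup>2 \<le> 2 * (norm a)\<^sup>2 + 2 * (norm b)\<^sup>2"
proof -
  have "(norm (a - b))\<^sup>2 \<le> (norm a + norm b)\<^sup>2"
    by (intro power_mono norm_triangle_ineq4) auto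
  also have "\<dots> \<le> 2 * (norm a)\<^sup>2 + 2 * (norm b)\<^sup>2"
    using sum_squares_bound[of "norm a" "norm b"] by (simp add: power2_sum)
  finally show ?thesis .
qed

lemma square_integrable_diff:
  assumes "square_integrable A f" "square_integrable A g"
  shows "square_integrable A (\<lambda>y. f y - g y)"
proof -
  have [measurable]: "f \<in> borel_measurable (lebesgue_on A)" "g \<in> borel_measurable (lebesgue_on A)"
    using assms by (auto simp: square_integrable_def)
  have "integrable (lebesgue_on A) (\<lambda>y. 2 * (norm (f y))\<^sup>2 + 2 * (norm (g y))\<^sup>2)"
    using assms by (auto simp: square_integrable_def)
  then have "integrable (lebesgue_on A) (\<lambda>y. (norm (f y - g y))\<^sup>2)"
  proof (rule Bochner_Integration.integrable_bound)
    show "AE y in lebesgue_on A. norm ((norm (f y - g y))\<^sup>2) \<le> norm (2 * (norm (f y))\<^sup>2 + 2 * (norm (g y))\<^sup>2)"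
      using norm_diff_square_le by (intro AE_I2) auto
  qed measurable
  then show ?thesis by (simp add: square_integrable_def)
qed

lemma L2_norm_on_nonneg: "0 \<le> L2_norm_on A f"
  by (simp add: L2_norm_on_def)

lemma L2_norm_on_square_diff_le:
  assumes "square_integrable A f" "square_integrable A g"
  shows "(L2_norm_on A (\<lambda>y. f y - g y))\<^sup>2 \<le> 2 * (L2_norm_on A f)\<^sup>2 + 2 * (L2_norm_on A g)\<^sup>2"
proof -
  have int: "integrable (lebesgue_on A) (\<lambda>y. (norm (f y))\<^sup>2)" "integrable (lebesgue_on A) (\<lambda>y. (norm (g y))\<^sup>2)"
    "integrable (lebesgue_on A) (\<lambda>y. (norm (f y - g y))\<^sup>2)"
    using assms square_integrable_diff[OF assms] by (auto simp: square_integrable_def)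
  have "(LINT y|lebesgue_on A. (norm (f y - g y))\<^sup>2) \<le> (LINT y|lebesgue_on A. 2 * (norm (f y))\<^sup>2 + 2 * (norm (g y))\<^sup>2)"
    using int norm_diff_square_le by (intro integral_mono) auto
  then show ?thesis using int by (simp add: L2_norm_on_def)
qed

lemma square_integrable_continuous:
  assumes "compact K" "continuous_on K f"
  shows "square_integrable K f"
proof -
  have K: "K \<in> sets lebesgue"
    using assms(1) by (intro fmeasurableD lmeasurable_compact)
  have f: "f \<in> borel_measurable (lebesgue_on K)"
    using assms(2) K by (rule continuous_imp_measurable_on_sets_lebesgue)
  obtain C where C: "\<forall>y\<in>K. norm (f y) \<le> C"
    using compact_imp_bounded[OF compact_continuous_image[OF assms(2,1)]] by (auto simp: bounded_iff)
  have "integrable (lebesgue_on K) (\<lambda>_. C\<^sup>2)"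
    by (intro finite_measure.integrable_const finite_measure_lebesgue_on lmeasurable_compact assms(1))
  then have "integrable (lebesgue_on K) (\<lambda>y. (norm (f y))\<^sup>2)"
  proof (rule Bochner_Integration.integrable_bound)
    show "AE y in lebesgue_on K. norm ((norm (f y))\<^sup>2) \<le> norm (C\<^sup>2)"
      using C by (intro AE_I2) (auto simp: power_mono)
  qed (use f in simp)
  with f show ?thesis by (simp add: square_integrable_def)
qed

section \<open>Needle sequences and the limit of the ratio\<close>

text \<open>The tip \<open>x\<close> lies on the path, so \<open>K\<close> avoids the singularity of
  \<open>G\<close> and \<open>G\<close> is square integrable there. The norms of the differences
  \<open>v n - G\<close> tend to 0, so those of \<open>v n\<close> stay bounded.\<close>

lemma needle_sequence_bounded:
  assumes v: "v \<in> needle_sequences \<Omega> k x \<sigma>" and x: "x \<in> path_image \<sigma>" and \<Omega>: "open \<Omega>"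
    and K: "compact K" "K \<subseteq> \<Omega> - path_image \<sigma>"
  obtains B where "B \<ge> 0" "eventually (\<lambda>n. square_integrable K (v n) \<and> (L2_norm_on K (v n))\<^sup>2 \<le> B) sequentially"
proof -
  have K_sets: "K \<in> sets lebesgue"
    using K(1) by (intro fmeasurableD lmeasurable_compact)
  have sq: "square_integrable K (v n)" for n
  proof -
    have "v n \<in> H1 \<Omega>" using v by (simp add: needle_sequences_def)
    then have "square_integrable \<Omega> (v n)" by (simp add: H1_def)
    moreover have "\<Omega> \<in> sets lebesgue" using \<Omega> by simp
    moreover have "K \<subseteq> \<Omega>" using K(2) by blast
    ultimately show ?thesis using square_integrable_subset K_sets by metis
  qed
  have "continuous_on K (\<lambda>z. G k z x)"
    using K(2) x unfolding G_def by (intro continuous_intros) auto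
  then have G: "square_integrable K (\<lambda>z. G k z x)"
    by (rule square_integrable_continuous[OF K(1)])
  let ?d = "\<lambda>n. L2_norm_on K (\<lambda>z. v n z - G k z x)"
  let ?e = "\<lambda>n. L2_norm_on K (weak_gradient (\<Omega> - {x}) (\<lambda>z. v n z - G k z x))"
  have "(\<lambda>n. ?d n + ?e n) \<longlonglongrightarrow> 0" using v K unfolding needle_sequences_def by blast
  then have "eventually (\<lambda>n. ?d n + ?e n < 1) sequentially" by (rule order_tendstoD) simp
  \<comment> \<open>The bound results from writing \<open>v n\<close> as \<open>v n - G\<close>
    minus \<open>- G\<close>, where the first norm is eventually at most 1; the gradient term is
    nonnegative and dropped.\<close>
  then have "eventually (\<lambda>n. square_integrable K (v n) \<and> (L2_norm_on K (v n))\<^sup>2 \<le> 2 + 2 * (L2_norm_on K (\<lambda>z. - G k z x))\<^sup>2) sequentially"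
  proof eventually_elim
    case (elim n)
    then have "?d n \<le> 1"
      using L2_norm_on_nonneg[of K "weak_gradient (\<Omega> - {x}) (\<lambda>z. v n z - G k z x)"] by linarith
    then have "(?d n)\<^sup>2 \<le> 1\<^sup>2" by (intro power_mono L2_norm_on_nonneg)
    moreover have "square_integrable K (\<lambda>z. - G k z x)" using G by (simp add: square_integrable_def)
    ultimately show ?case
      using L2_norm_on_square_diff_le[OF square_integrable_diff[OF sq[of n] G], of "\<lambda>z. - G k z x"] sq[of n] by simp
  qed
  then show ?thesis by (rule that[rotated]) simp
qed

text \<open>After division by the square of \<open>c n\<close>, the term with \<open>B\<close>
  vanishes in the limit, and the remaining \<open>M * \<epsilon>\<^sup>2\<close> is arbitrarily
  small because \<open>M\<close> is fixed before \<open>\<epsilon>\<close>.\<close>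

lemma tendsto_ratio_0_of_interpolation:
  fixes a c :: "nat \<Rightarrow> real"
  assumes c: "filterlim c at_top sequentially" and a: "\<And>n. 0 \<le> a n" and M: "0 \<le> M"
    and bound: "\<And>\<epsilon>. \<epsilon> > 0 \<Longrightarrow> \<exists>B. eventually (\<lambda>n. (a n)\<^sup>2 \<le> M * (B + \<epsilon>\<^sup>2 * (c n)\<^sup>2)) sequentially"
  shows "(\<lambda>n. a n / c n) \<longlonglongrightarrow> 0"
proof (rule tendstoI)
  fix \<delta> :: real assume \<delta>: "\<delta> > 0"
  \<comment> \<open>Makes \<open>M * \<epsilon>\<^sup>2\<close> at most half of
    \<open>\<delta>\<^sup>2\<close>; \<open>M + 1\<close> in place of \<open>M\<close> keeps the
    denominator positive.\<close>
  define \<epsilon> where "\<epsilon> = \<delta> / sqrt (2 * (M + 1))"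
  have "\<epsilon> > 0" using \<delta> M by (simp add: \<epsilon>_def)
  have "\<epsilon>\<^sup>2 = \<delta>\<^sup>2 / (2 * (M + 1))" using M by (simp add: \<epsilon>_def power_divide)
  then have "2 * \<epsilon>\<^sup>2 + 2 * (M * \<epsilon>\<^sup>2) = \<delta>\<^sup>2" using M by (simp add: field_simps)
  then have M\<epsilon>: "M * \<epsilon>\<^sup>2 \<le> \<delta>\<^sup>2 / 2" using zero_le_power2[of \<epsilon>] by linarith
  obtain B where B: "eventually (\<lambda>n. (a n)\<^sup>2 \<le> M * (B + \<epsilon>\<^sup>2 * (c n)\<^sup>2)) sequentially"
    using bound[OF \<open>\<epsilon> > 0\<close>] by blast
  \<comment> \<open>The second threshold makes the term \<open>M * B\<close> smaller than the other
    half; \<open>c n > 1\<close> lets a bound on \<open>c n\<close> pass to its square.\<close>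
  have "eventually (\<lambda>n. c n > max 1 (2 * (M * B) / \<delta>\<^sup>2)) sequentially"
    using c unfolding filterlim_at_top_dense by blast
  with B show "eventually (\<lambda>n. dist (a n / c n) 0 < \<delta>) sequentially"
  proof eventually_elim
    case (elim n)
    then have c1: "c n > 1" and c2: "2 * (M * B) / \<delta>\<^sup>2 < c n" by auto
    have "c n \<le> (c n)\<^sup>2" using c1 by (simp add: power2_eq_square)
    with c2 have "2 * (M * B) / \<delta>\<^sup>2 < (c n)\<^sup>2" by linarith
    then have "M * B < \<delta>\<^sup>2 / 2 * (c n)\<^sup>2" using \<delta> by (simp add: field_simps)
    moreover have "M * \<epsilon>\<^sup>2 * (c n)\<^sup>2 \<le> \<delta>\<^sup>2 / 2 * (c n)\<^sup>2" using M\<epsilon> by (intro mult_right_mono) auto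
    ultimately have "(a n)\<^sup>2 < \<delta>\<^sup>2 * (c n)\<^sup>2" using elim(1) by (simp add: algebra_simps)
    then have "a n < \<delta> * c n"
      using \<delta> c1 by (intro power_less_imp_less_base[of "a n" 2]) (auto simp: power_mult_distrib)
    then show ?case using a[of n] c1 by (simp add: field_simps)
  qed
qed

theorem theorem1p3:
  fixes \<Omega> D :: "(real^3) set" and Dc :: "nat \<Rightarrow> (real^3) set" and N :: nat
    and k :: real and x :: "real^3" and \<sigma> :: "real \<Rightarrow> real^3"
    and v :: "nat \<Rightarrow> real^3 \<Rightarrow> complex"
  assumes "open \<Omega>" and "connected \<Omega>" and "bounded \<Omega>" and "lipschitz_boundary \<Omega>"
    and "0 \<le> k"
    and "open D" and "D \<noteq> {}" and "closure D \<subseteq> \<Omega>"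
    and "1 \<le> N" and "D = (\<Union>j\<in>{1..N}. Dc j)"
    and "\<And>j. j \<in> {1..N} \<Longrightarrow> Dc j \<in> components D"
    and "\<And>j. j \<in> {1..N} \<Longrightarrow> lipschitz_boundary (Dc j)"
    and "\<And>j l. j \<in> {1..N} \<Longrightarrow> l \<in> {1..N} \<Longrightarrow> j \<noteq> l \<Longrightarrow> closure (Dc j) \<inter> closure (Dc l) = {}"
    and "x \<in> \<Omega>" and "\<sigma> \<in> needles \<Omega> x"
    and "v \<in> needle_sequences \<Omega> k x \<sigma>"
    and "filterlim (\<lambda>n. L2_norm_on D (weak_gradient \<Omega> (v n))) at_top sequentially"
  shows "(\<lambda>n. L2_norm_on D (v n) / L2_norm_on D (weak_gradient \<Omega> (v n))) \<longlonglongrightarrow> 0"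
proof -
  let ?g = "\<lambda>n. weak_gradient \<Omega> (v n)"
  have H1: "v n \<in> H1 \<Omega>" for n using assms(16) by (simp add: needle_sequences_def)
  \<comment> \<open>Membership in \<open>H1\<close> supplies some weak gradient, so the chosen
    \<open>?g n\<close> is a genuine one.\<close>
  then have weak: "has_weak_gradient \<Omega> (v n) (?g n)" for n
    unfolding weak_gradient_def H1_def by (metis (mono_tags, lifting) mem_Collect_eq someI_ex)
  have \<sigma>: "piecewise_linear \<sigma>" "path \<sigma>" "x \<in> path_image \<sigma>"
    using assms(15) arc_imp_path pathfinish_in_path_image[of \<sigma>] by (auto simp: needles_def pathfinish_def)
  have D: "bounded D" "D \<subseteq> \<Omega>" "D \<in> sets lebesgue"
    using bounded_subset[OF assms(3)] assms(6,8) closure_subset[of D] by auto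
  \<comment> \<open>The Lipschitz condition concerns the individual components. Shifts that stay in
    \<open>Dc j\<close> stay in \<open>D\<close>, so the covers of the components can be
    united.\<close>
  have "\<exists>\<U>. finite \<U> \<and> Dc j \<subseteq> \<Union>\<U> \<and> (\<forall>U\<in>\<U>. shiftable U D)" if j: "j \<in> {1..N}" for j
  proof -
    have sub: "Dc j \<subseteq> D" using assms(11)[OF j] by (rule in_components_subset)
    moreover have "open (Dc j)" using assms(6) assms(11)[OF j] by (rule open_components)
    moreover have "bounded (Dc j)" using D(1) sub by (rule bounded_subset)
    ultimately show ?thesis
      using lipschitz_boundary_finite_cover[OF assms(12)[OF j]] shiftable_mono by metis
  qed
  then have "\<forall>j\<in>{1..N}. \<exists>\<U>. finite \<U> \<and> Dc j \<subseteq> \<Union>\<U> \<and> (\<forall>U\<in>\<U>. shiftable U D)" by blast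
  from bchoice[OF this] obtain \<U> where \<U>: "\<forall>j\<in>{1..N}. finite (\<U> j) \<and> Dc j \<subseteq> \<Union>(\<U> j) \<and> (\<forall>U\<in>\<U> j. shiftable U D)"
    by blast
  let ?U = "\<Union>j\<in>{1..N}. \<U> j"
  have fin: "finite ?U" using \<U> by blast
  have cover: "D \<subseteq> \<Union>?U" 
  proof
    fix y assume "y \<in> D"
    then obtain j where j: "j \<in> {1..N}" "y \<in> Dc j" using assms(10) by blast
    then have "y \<in> \<Union>(\<U> j)" using bspec[OF \<U> j(1)] by blast
    then show "y \<in> \<Union>?U" using j(1) by blast
  qed
  have shift: "\<forall>U\<in>?U. shiftable U D" using \<U> by blast
  have v_sq: "square_integrable D (v n)" for n
  proof -
    have "square_integrable \<Omega> (v n)" using H1[of n] by (simp add: H1_def)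
    moreover have "\<Omega> \<in> sets lebesgue" using assms(1) by simp
    ultimately show ?thesis using square_integrable_subset D(2,3) by metis
  qed
  show ?thesis
  proof (rule tendsto_ratio_0_of_interpolation[OF assms(17) L2_norm_on_nonneg, of "3 * real (card ?U)"])
    fix \<epsilon> :: real assume \<epsilon>: "\<epsilon> > 0"
    \<comment> \<open>\<open>K\<close> depends on \<open>\<epsilon>\<close> but not on n, so a
      single \<open>B\<close> bounds the norms on \<open>K\<close> for all large n.\<close>
    obtain K where K: "compact K" "K \<subseteq> closure D - path_image \<sigma>"
      and bound: "\<forall>v g. has_weak_gradient \<Omega> v g \<longrightarrow> square_nn_integral D v
        \<le> of_nat (card ?U) * (3 * square_nn_integral K v + 2 * ennreal (\<epsilon>\<^sup>2) * square_nn_integral D g)"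
      by (rule weak_gradient_interpolation[OF assms(1,6) D(1) assms(8) fin cover shift \<sigma>(1,2) \<epsilon>]) (rule that)
    have K_sets: "K \<in> sets lebesgue"
    using K(1) by (intro fmeasurableD lmeasurable_compact)
    have "K \<subseteq> \<Omega> - path_image \<sigma>" using K(2) assms(8) by blast
    then obtain B where "B \<ge> 0" and B: "eventually (\<lambda>n. square_integrable K (v n) \<and> (L2_norm_on K (v n))\<^sup>2 \<le> B) sequentially"
      by (rule needle_sequence_bounded[OF assms(16) \<sigma>(3) assms(1) K(1)])
    have "eventually (\<lambda>n. L2_norm_on D (?g n) > 0) sequentially"
      using assms(17) by (simp add: filterlim_at_top_dense)
    with B have "eventually (\<lambda>n. (L2_norm_on D (v n))\<^sup>2 \<le> 3 * real (card ?U) * (B + \<epsilon>\<^sup>2 * (L2_norm_on D (?g n))\<^sup>2)) sequentially"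
    proof eventually_elim
      case (elim n)
      \<comment> \<open>Without integrability the norm would have the junk value \<open>0\<close>.\<close>
      have g: "integrable (lebesgue_on D) (\<lambda>y. (norm (?g n y))\<^sup>2)"
        using elim(2) not_integrable_integral_eq by (fastforce simp: L2_norm_on_def)
      have "ennreal ((L2_norm_on D (v n))\<^sup>2) = square_nn_integral D (v n)"
        using v_sq D(3) by (subst square_nn_integral_eq_L2_norm_on) (auto simp: square_integrable_def)
      also have "\<dots> \<le> of_nat (card ?U) * (3 * square_nn_integral K (v n) + 2 * ennreal (\<epsilon>\<^sup>2) * square_nn_integral D (?g n))"
        using bound weak by blast
      also have "square_nn_integral K (v n) = ennreal ((L2_norm_on K (v n))\<^sup>2)"
        using elim(1) K_sets by (intro square_nn_integral_eq_L2_norm_on) (auto simp: square_integrable_def)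
      also have "square_nn_integral D (?g n) = ennreal ((L2_norm_on D (?g n))\<^sup>2)"
        by (rule square_nn_integral_eq_L2_norm_on[OF D(3) g])
      also have "of_nat (card ?U) * (3 * ennreal ((L2_norm_on K (v n))\<^sup>2) + 2 * ennreal (\<epsilon>\<^sup>2) * ennreal ((L2_norm_on D (?g n))\<^sup>2))
          = ennreal (real (card ?U) * (3 * (L2_norm_on K (v n))\<^sup>2 + 2 * \<epsilon>\<^sup>2 * (L2_norm_on D (?g n))\<^sup>2))"
        by (simp add: ennreal_mult ennreal_of_nat_eq_real_of_nat)
      finally have "(L2_norm_on D (v n))\<^sup>2 \<le> real (card ?U) * (3 * (L2_norm_on K (v n))\<^sup>2 + 2 * \<epsilon>\<^sup>2 * (L2_norm_on D (?g n))\<^sup>2)"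
        by (subst (asm) ennreal_le_iff) auto
      \<comment> \<open>The coefficient 2 is raised to 3 so that the common factor
        \<open>3 * real (card ?U)\<close> can be taken out.\<close>
      also have "\<dots> \<le> real (card ?U) * (3 * B + 3 * \<epsilon>\<^sup>2 * (L2_norm_on D (?g n))\<^sup>2)"
        using elim(1) by (intro mult_left_mono add_mono mult_right_mono) auto
      finally show ?case by (simp add: algebra_simps)
    qed
    then show "\<exists>B. eventually (\<lambda>n. (L2_norm_on D (v n))\<^sup>2 \<le> 3 * real (card ?U) * (B + \<epsilon>\<^sup>2 * (L2_norm_on D (?g n))\<^sup>2)) sequentially"
      by blast
  qed simp
qed

end
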